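(* Let $V$ be a (finite or countably infinite) bipartite lattice whose vertices have degree $k+1$, where $k\ge2$. For blocking RSA on $V$, for any vertex $v$ and any $t\in[0,1]$, $$P[X_t^V(v)=0]\le\frac12\Big(1+\frac1{(1+(k-1)t)^{2/(k-1)}}\Big).$$ In particular, $$P[X_1^V(v)=0]\le\tfrac12\big(1+k^{-2/(k-1)}\big),\qquad\text{so}\qquad P[X_1^V(v)=1]\ge\tfrac12\big(1-k^{-2/(k-1)}\big).$$
   Context: Graphs have no loops or multiple edges. A bipartite lattice is the vertex set $V$ of a bipartite graph such that for any $v_1,v_2,w_1,w_2\in V$ with $v_1$ adjacent to $v_2$ and $w_1$ adjacent to $w_2$, there exists a graph isomorphism from $V$ to itself sending $v_i$ to $w_i$, $i=1,2$. Blocking RSA on a finite graph $V$: $\tau_v$, $v\in V$, are i.i.d. uniform on $(0,1)$. All sites are initially vacant (state $0$); at time $\tau_v$ site $v$ becomes occupied (state $1$) if and only if none of its neighbours is already occupied; otherwise nothing changes at that time. Occupied sites stay occupied forever. $X_t^V(v)\in\{0,1\}$ is the state of $v$ at time $t$. For countably infinite $V$ of bounded degree, $X_t^V(v):=\lim_n X_t^{V_n}(v)$, where $(V_n)$ is any sequence of finite subsets of $V$ with $\bigcup_n\bigcap_{m\ge n}V_m=V$ and the process on the induced subgraph $V_n$ uses the same $(\tau_v)$; almost surely this limit exists for all $v,t$ and does not depend on the sequence. *)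

theory Defs
  imports "HOL-Probability.Probability"
begin

definition simple_graph :: "'a set \<Rightarrow> ('a \<Rightarrow> 'a \<Rightarrow> bool) \<Rightarrow> bool" where
  "simple_graph V adj \<longleftrightarrow>
     (\<forall>x y. adj x y \<longrightarrow> x \<in> V \<and> y \<in> V \<and> x \<noteq> y \<and> adj y x)"

definition bipartite :: "'a set \<Rightarrow> ('a \<Rightarrow> 'a \<Rightarrow> bool) \<Rightarrow> bool" where
  "bipartite V adj \<longleftrightarrow>
     (\<exists>A B. A \<union> B = V \<and> A \<inter> B = {} \<and>
        (\<forall>x y. adj x y \<longrightarrow> (x \<in> A \<and> y \<in> B) \<or> (x \<in> B \<and> y \<in> A)))"

definition graph_automorphism :: "'a set \<Rightarrow> ('a \<Rightarrow> 'a \<Rightarrow> bool) \<Rightarrow> ('a \<Rightarrow> 'a) \<Rightarrow> bool" where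
  "graph_automorphism V adj \<phi> \<longleftrightarrow>
     bij_betw \<phi> V V \<and> (\<forall>x\<in>V. \<forall>y\<in>V. adj (\<phi> x) (\<phi> y) \<longleftrightarrow> adj x y)"

text \<open>
  Connectedness is not required, and automorphisms need not preserve a given bipartition
  (taking \<open>w1 = v2\<close> and \<open>w2 = v1\<close>, some of them must exchange the two ends of an edge).
\<close>

definition bipartite_lattice :: "'a set \<Rightarrow> ('a \<Rightarrow> 'a \<Rightarrow> bool) \<Rightarrow> bool" where
  "bipartite_lattice V adj \<longleftrightarrow>
     simple_graph V adj \<and> bipartite V adj \<and>
     (\<forall>v1 v2 w1 w2. adj v1 v2 \<longrightarrow> adj w1 w2 \<longrightarrow>
        (\<exists>\<phi>. graph_automorphism V adj \<phi> \<and> \<phi> v1 = w1 \<and> \<phi> v2 = w2))"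

definition vertex_degree :: "'a set \<Rightarrow> ('a \<Rightarrow> 'a \<Rightarrow> bool) \<Rightarrow> 'a \<Rightarrow> nat" where
  "vertex_degree V adj v = card {w \<in> V. adj v w}"

text \<open>
  The arrival at \<open>v\<close> in the process on the subgraph induced by the finite set \<open>W\<close> succeeds,
  for the arrival times \<open>\<tau>\<close>. A neighbour is already occupied at time \<open>\<tau> v\<close> iff its own
  arrival was strictly earlier and successful. Ties between arrival times have probability
  zero. The value for infinite \<open>W\<close> is a dummy.
\<close>

function occupied_on_arrival ::
    "('a \<Rightarrow> 'a \<Rightarrow> bool) \<Rightarrow> 'a set \<Rightarrow> ('a \<Rightarrow> real) \<Rightarrow> 'a \<Rightarrow> bool" where
  "occupied_on_arrival adj W \<tau> v =
     (if finite W
      then v \<in> W \<and>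
        (\<forall>w\<in>W. adj v w \<longrightarrow> \<tau> w < \<tau> v \<longrightarrow> \<not> occupied_on_arrival adj W \<tau> w)
      else False)"
  by pat_completeness auto
termination
proof (relation "Wellfounded.measure (\<lambda>(adj, W, \<tau>, v). card {u \<in> W. \<tau> u < \<tau> v})")
  fix adj :: "'a \<Rightarrow> 'a \<Rightarrow> bool" and W :: "'a set" and \<tau> :: "'a \<Rightarrow> real" and v w
  assume "finite W" "w \<in> W" "\<tau> w < \<tau> v"
  then have "{u \<in> W. \<tau> u < \<tau> w} \<subset> {u \<in> W. \<tau> u < \<tau> v}"
    by auto
  with \<open>finite W\<close> show "((adj, W, \<tau>, w), (adj, W, \<tau>, v))
      \<in> Wellfounded.measure (\<lambda>(adj, W, \<tau>, v). card {u \<in> W. \<tau> u < \<tau> v})"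
    by (simp add: psubset_card_mono)
qed simp

declare occupied_on_arrival.simps [simp del]

definition rsa_finite ::
    "('a \<Rightarrow> 'a \<Rightarrow> bool) \<Rightarrow> 'a set \<Rightarrow> ('a \<Rightarrow> real) \<Rightarrow> real \<Rightarrow> 'a \<Rightarrow> nat" where
  "rsa_finite adj W \<tau> t v = (if \<tau> v \<le> t \<and> occupied_on_arrival adj W \<tau> v then 1 else 0)"

definition exhausts :: "(nat \<Rightarrow> 'a set) \<Rightarrow> 'a set \<Rightarrow> bool" where
  "exhausts Vn V \<longleftrightarrow>
     (\<forall>n. finite (Vn n) \<and> Vn n \<subseteq> V) \<and> (\<Union>n. \<Inter>m\<in>{n..}. Vn m) = V"

text \<open>
  The sequence \<open>Vn\<close> is only used when \<open>V\<close> is infinite. The limit exists, and does not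
  depend on \<open>Vn\<close>, only almost surely, so \<open>Vn\<close> is kept as a parameter.
\<close>

definition rsa ::
    "('a \<Rightarrow> 'a \<Rightarrow> bool) \<Rightarrow> 'a set \<Rightarrow> (nat \<Rightarrow> 'a set) \<Rightarrow> ('a \<Rightarrow> real) \<Rightarrow> real \<Rightarrow> 'a \<Rightarrow> nat" where
  "rsa adj V Vn \<tau> t v =
     (if finite V then rsa_finite adj V \<tau> t v
      else lim (\<lambda>n. rsa_finite adj (Vn n) \<tau> t v))"

definition iid_uniform :: "'w measure \<Rightarrow> ('a \<Rightarrow> 'w \<Rightarrow> real) \<Rightarrow> 'a set \<Rightarrow> bool" where
  "iid_uniform M \<tau> V \<longleftrightarrow>
     prob_space.indep_vars M (\<lambda>_. borel) \<tau> V \<and>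
     (\<forall>v\<in>V. distr M borel (\<tau> v) = uniform_measure lborel {0<..<1})"

end

theory Submission
  imports Defs
begin

text \<open>
  Let \<open>q t = (1 + (k - 1) * t) powr (- 1 / (k - 1))\<close>, the solution of \<open>q' = - q ^ k\<close> with
  \<open>q 0 = 1\<close>.  On the tree in which every vertex has \<open>k\<close> children, \<open>q t\<close> is the probability that
  the root is vacant, and the bound to be proved is \<open>(1 + q t ^ 2) / 2\<close>.  The theorem says that
  cycles can only help occupation, and the reason is positive correlation.

  On a bipartite graph the process is monotone: earlier arrivals in one colour class and later ones
  in the other favour occupation in the first class (\<open>occupied_mono\<close>).  Hence, by Harris'
  inequality for independent variables, vacancies of sites of one colour are positively correlated
  (\<open>vacancies_positively_correlated\<close>).  Conditioning on the arrival time of a site \<open>w\<close>, its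
  vacancy probability decreases at time \<open>s\<close> at the rate at which all its neighbours are vacant at
  time \<open>s\<close> in the graph without \<open>w\<close> (\<open>vacancy_has_derivative\<close>).

  Let \<open>v\<close> and \<open>w\<close> be adjacent, and let \<open>b\<close> be the probability that \<open>w\<close> is vacant in the graph
  without \<open>v\<close>; in the lattice it is the same for all oriented edges.  Two inequalities suffice.

  First, \<open>b' \<le> - b ^ k\<close>, hence \<open>b \<le> q\<close>.  Indeed \<open>- b'\<close> is the probability that the \<open>k\<close>
  neighbours of \<open>w\<close> other than \<open>v\<close> are all vacant in the graph without \<open>v\<close> and \<open>w\<close>.  By positive
  correlation this is at least the product of the single probabilities, and putting back \<open>v\<close>,
  which has the colour of these neighbours, turns each factor into a \<open>b\<close> (\<open>cavity_vacancy_ge\<close>).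

  Second, if \<open>p v\<close> denotes the vacancy probability of \<open>v\<close> in the whole graph, then
  \<open>p v + p w - 1 \<le> b * b\<close> (\<open>vacancy_pair_le\<close>).  The left-hand side is the probability that both
  ends of the edge are vacant.  The inequality follows by comparing derivatives: that all
  neighbours of \<open>v\<close> are vacant in the graph without \<open>v\<close> means that \<open>w\<close> is vacant there and that
  the other neighbours are vacant in the graph without both, and these events are positively
  correlated (\<open>vacancy_neighbours_ge\<close>).  Since \<open>p v = p w\<close>, it follows that
  \<open>p v \<le> (1 + q ^ 2) / 2\<close>.

  Symmetry holds only in the whole lattice, while the process is defined on finite subgraphs.  The
  two are reconciled by locality: the state of \<open>v\<close> is determined by the ball of radius \<open>n\<close> unless
  some path of length \<open>n\<close> from \<open>v\<close> has decreasing arrival times, which has probability at most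
  \<open>(k + 1) ^ n / (n + 1)!\<close> (\<open>vacancy_local\<close>).  So the identities that symmetry gives on the lattice
  hold on finite subgraphs up to this error, the same differential inequalities go through with
  it (\<open>cavity_vacancy_le\<close>, \<open>vacancy_le\<close>), and it disappears in the end.
\<close>

section \<open>The process for given arrival times\<close>

lemma arrival_time_induct [consumes 1, case_names earlier]:
  fixes X :: "'a \<Rightarrow> real"
  assumes "finite W"
    and "\<And>v. (\<And>w. w \<in> W \<Longrightarrow> X w < X v \<Longrightarrow> P w) \<Longrightarrow> P v"
  shows "P v"
proof (induction "card {u \<in> W. X u < X v}" arbitrary: v rule: less_induct)
  case less
  show ?case
  proof (rule assms(2))
    fix w assume "w \<in> W" "X w < X v"
    then have "{u \<in> W. X u < X w} \<subset> {u \<in> W. X u < X v}" by auto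
    with \<open>finite W\<close> have "card {u \<in> W. X u < X w} < card {u \<in> W. X u < X v}"
      by (simp add: psubset_card_mono)
    then show "P w" by (rule less)
  qed
qed

lemma occupied_iff:
  assumes "finite W"
  shows "occupied_on_arrival adj W X v \<longleftrightarrow>
    v \<in> W \<and> (\<forall>w\<in>W. adj v w \<longrightarrow> X w < X v \<longrightarrow> \<not> occupied_on_arrival adj W X w)"
  using assms by (subst occupied_on_arrival.simps) simp

lemma occupied_imp_mem: "finite W \<Longrightarrow> occupied_on_arrival adj W X v \<Longrightarrow> v \<in> W"
  using occupied_iff by metis

lemma occupied_cong:
  assumes "finite W" and "\<And>u. u \<in> W \<Longrightarrow> X u = Y u"
  shows "occupied_on_arrival adj W X v = occupied_on_arrival adj W Y v"
  using assms(1)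
proof (induction v rule: arrival_time_induct[where X = X])
  case (earlier v)
  then show ?case
    unfolding occupied_iff[OF assms(1), of adj X v] occupied_iff[OF assms(1), of adj Y v]
    using assms(2) by metis
qed

text \<open>
  A site influences the others only by being occupied, so one that is still vacant at time \<open>s\<close>
  can be deleted without changing what happens elsewhere before \<open>s\<close>.
\<close>

lemma occupied_delete_vacant:
  assumes "finite W" and w: "\<not> (occupied_on_arrival adj W X w \<and> X w < s)"
    and "u \<noteq> w" and "X u < s"
  shows "occupied_on_arrival adj W X u = occupied_on_arrival adj (W - {w}) X u"
  using assms(1) \<open>u \<noteq> w\<close> \<open>X u < s\<close>
proof (induction u rule: arrival_time_induct[where X = X])
  case (earlier u)
  have "\<not> occupied_on_arrival adj W X w" if "X w < X u"
    using that w earlier.prems by auto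
  moreover have "occupied_on_arrival adj W X x = occupied_on_arrival adj (W - {w}) X x"
    if "x \<in> W" "X x < X u" "x \<noteq> w" for x
    using earlier that by auto
  ultimately show ?case
    unfolding occupied_iff[OF assms(1), of adj X u] occupied_iff[OF finite_Diff[OF assms(1)], of adj _ X u]
    using earlier.prems by blast
qed

text \<open>
  For a site \<open>u\<close> arriving before \<open>s\<close>, resetting the arrival of \<open>w\<close> to \<open>s\<close> and deleting \<open>w\<close>
  come to the same thing.  This is what turns conditioning on an arrival time into the process
  on a smaller graph.
\<close>

lemma occupied_delete_later:
  assumes "finite W" "X u < s" "u \<noteq> w"
  shows "occupied_on_arrival adj W (X(w := s)) u = occupied_on_arrival adj (W - {w}) X u"
proof -
  have "occupied_on_arrival adj W (X(w := s)) u = occupied_on_arrival adj (W - {w}) (X(w := s)) u"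
    using assms by (intro occupied_delete_vacant[where s = s]) auto
  also have "\<dots> = occupied_on_arrival adj (W - {w}) X u"
    using assms by (intro occupied_cong) auto
  finally show ?thesis .
qed

text \<open>
  A recursion over the finite set \<open>W\<close> instead of over the order of the arrival times: the
  latter depends on \<open>X\<close>, so only this form can be used to show measurability in \<open>X\<close>.
\<close>

lemma occupied_iff_delete:
  assumes "finite W"
  shows "occupied_on_arrival adj W X v \<longleftrightarrow>
    v \<in> W \<and> (\<forall>w\<in>W - {v}. adj v w \<longrightarrow> X w < X v \<longrightarrow> \<not> occupied_on_arrival adj (W - {v}) X w)"
  unfolding occupied_iff[OF assms, of adj X v]
  using occupied_delete_vacant[OF assms, of adj X v "X v"]
  by (metis Diff_iff less_irrefl singletonD)

text \<open>
  Only arrivals strictly before \<open>t\<close> count.  With this choice the state of a site on its arrival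
  is expressed by the vacancy of its neighbours for every family of arrival times, ties included.
\<close>

definition vacant_before ::
    "('a \<Rightarrow> 'a \<Rightarrow> bool) \<Rightarrow> 'a set \<Rightarrow> 'a set \<Rightarrow> real \<Rightarrow> ('a \<Rightarrow> real) \<Rightarrow> bool" where
  "vacant_before adj W U t X \<longleftrightarrow> (\<forall>u\<in>U. \<not> (occupied_on_arrival adj W X u \<and> X u < t))"

lemma vacant_before_cong:
  assumes "finite W" "\<And>u. u \<in> W \<Longrightarrow> X u = Y u"
  shows "vacant_before adj W U t X = vacant_before adj W U t Y"
proof -
  have "occupied_on_arrival adj W X u \<and> X u < t \<longleftrightarrow> occupied_on_arrival adj W Y u \<and> Y u < t" for u
    using assms(2)[of u] occupied_imp_mem[OF assms(1), of adj Y u]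
    by (auto simp: occupied_cong[OF assms])
  then show ?thesis by (simp only: vacant_before_def)
qed

lemma vacant_before_at_arrival:
  assumes "finite W" "w \<in> W" "\<And>x. \<not> adj x x"
  shows "occupied_on_arrival adj W (X(w := s)) w \<longleftrightarrow>
    vacant_before adj (W - {w}) {u \<in> W. adj w u} s X"
proof -
  have "occupied_on_arrival adj W (X(w := s)) w \<longleftrightarrow>
      (\<forall>u\<in>W. adj w u \<longrightarrow> X u < s \<longrightarrow> \<not> occupied_on_arrival adj W (X(w := s)) u)"
    using assms by (subst occupied_iff) auto
  also have "\<dots> \<longleftrightarrow> vacant_before adj (W - {w}) {u \<in> W. adj w u} s X"
    using assms occupied_delete_later[OF \<open>finite W\<close>, of X _ s w adj]
    by (auto simp: vacant_before_def)
  finally show ?thesis .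
qed

text \<open>
  If \<open>w\<close> is vacant before \<open>s\<close> it has not influenced the others, so the remaining sites may be
  observed in the process without \<open>w\<close>.
\<close>

lemma vacant_before_split:
  assumes "finite W" "w \<in> U"
  shows "vacant_before adj W U s X \<longleftrightarrow>
    vacant_before adj W {w} s X \<and> vacant_before adj (W - {w}) (U - {w}) s X"
  using \<open>w \<in> U\<close> occupied_delete_vacant[OF \<open>finite W\<close>, of adj X w s]
  unfolding vacant_before_def by blast

text \<open>
  The order in which the process is monotone: earlier arrivals on \<open>A\<close>, later ones off \<open>A\<close>.
\<close>

definition tilted_le :: "'a set \<Rightarrow> ('a \<Rightarrow> real) \<Rightarrow> ('a \<Rightarrow> real) \<Rightarrow> bool" where
  "tilted_le A X Y \<longleftrightarrow> (\<forall>a\<in>A. Y a \<le> X a) \<and> (\<forall>b. b \<notin> A \<longrightarrow> X b \<le> Y b)"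

locale two_coloured_graph =
  fixes adj :: "'a \<Rightarrow> 'a \<Rightarrow> bool" and A :: "'a set"
  assumes adj_cross: "adj x y \<Longrightarrow> x \<in> A \<longleftrightarrow> y \<notin> A"
begin

lemma swap_colours: "two_coloured_graph adj (- A)"
  by unfold_locales (use adj_cross in blast)

lemma irrefl: "\<not> adj x x"
  using adj_cross by blast

text \<open>
  Arriving earlier helps one's own colour class and harms the other one.  If \<open>a\<close> were occupied
  for \<open>X\<close> but not for \<open>Y\<close>, it would be blocked for \<open>Y\<close> by an earlier neighbour \<open>b\<close> of the other
  colour, which for \<open>X\<close> is earlier still, hence itself blocked by an even earlier \<open>a'\<close> of the
  first colour, to which the same argument applies.
\<close>

lemma occupied_mono:
  assumes fin: "finite W" "finite W'"
    and dom: "W \<inter> A \<subseteq> W'" "W' - A \<subseteq> W"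
    and A_earlier: "\<And>a. a \<in> A \<Longrightarrow> Y a \<le> X a"
    and B_later: "\<And>b. b \<notin> A \<Longrightarrow> X b \<le> Y b"
    and "a \<in> A" "occupied_on_arrival adj W X a"
  shows "occupied_on_arrival adj W' Y a"
  using fin(1) \<open>a \<in> A\<close> \<open>occupied_on_arrival adj W X a\<close>
proof (induction a rule: arrival_time_induct[where X = X])
  case (earlier a)
  have a: "a \<in> W" "\<And>w. w \<in> W \<Longrightarrow> adj a w \<Longrightarrow> X w < X a \<Longrightarrow> \<not> occupied_on_arrival adj W X w"
    using earlier.prems(2) unfolding occupied_iff[OF fin(1), of adj X a] by auto
  have "\<not> occupied_on_arrival adj W' Y b" if b: "b \<in> W'" "adj a b" "Y b < Y a" for b
  proof
    assume occ: "occupied_on_arrival adj W' Y b"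
    have "b \<notin> A" using adj_cross[OF \<open>adj a b\<close>] earlier.prems(1) by blast
    have "X b < X a"
      using b A_earlier[OF \<open>a \<in> A\<close>] B_later[OF \<open>b \<notin> A\<close>] by linarith
    moreover have "b \<in> W" using b \<open>b \<notin> A\<close> dom by blast
    ultimately obtain a' where a': "a' \<in> W" "adj b a'" "X a' < X b" "occupied_on_arrival adj W X a'"
      using a(2)[of b] b unfolding occupied_iff[OF fin(1), of adj X b] by auto
    have "a' \<in> A" using adj_cross[OF \<open>adj b a'\<close>] \<open>b \<notin> A\<close> by blast
    have "occupied_on_arrival adj W' Y a'"
      using earlier.IH[of a'] a' \<open>a' \<in> A\<close> \<open>X b < X a\<close> by auto
    moreover have "Y a' < Y b"
      using A_earlier[OF \<open>a' \<in> A\<close>] B_later[OF \<open>b \<notin> A\<close>] a' by linarith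
    moreover have "a' \<in> W'" using a' \<open>a' \<in> A\<close> dom by blast
    ultimately show False
      using occ a'(2) unfolding occupied_iff[OF fin(2), of adj Y b] by auto
  qed
  then show ?case
    using a(1) earlier.prems(1) dom unfolding occupied_iff[OF fin(2), of adj Y a] by auto
qed

lemma vacant_before_mono:
  assumes fin: "finite W" "finite W'"
    and dom: "W \<inter> A \<subseteq> W'" "W' - A \<subseteq> W"
    and le: "tilted_le A X Y"
    and "U \<inter> A = {}" "vacant_before adj W U t X"
  shows "vacant_before adj W' U t Y"
  unfolding vacant_before_def
proof (intro ballI notI; elim conjE)
  fix b assume b: "b \<in> U" "occupied_on_arrival adj W' Y b" "Y b < t"
  interpret B: two_coloured_graph adj "- A" by (rule swap_colours)
  have "b \<notin> A" using b assms by auto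
  have "occupied_on_arrival adj W X b"
    by (rule B.occupied_mono[OF fin(2,1), where X = Y])
       (use b \<open>b \<notin> A\<close> dom le in \<open>auto simp: tilted_le_def\<close>)
  moreover have "X b < t" using le b \<open>b \<notin> A\<close> by (force simp: tilted_le_def)
  ultimately show False using b assms by (auto simp: vacant_before_def)
qed

end

section \<open>Independent uniform arrival times\<close>

abbreviation uniform_clock :: "real measure" where
  "uniform_clock \<equiv> uniform_measure lborel {0<..<1}"

text \<open>
  Arrival times are attached to all elements of the type, not only to the vertices of one graph,
  so that processes on different graphs live on the same space, whose underlying set is
  everything.
\<close>

definition clocks :: "('a \<Rightarrow> real) measure" where
  "clocks = (\<Pi>\<^sub>M i\<in>UNIV. uniform_clock)"

lemma prob_space_uniform_clock: "prob_space uniform_clock"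
  by (intro prob_space_uniform_measure) auto

interpretation uniform_clock: prob_space uniform_clock
  by (rule prob_space_uniform_clock)

interpretation clocks: prob_space "clocks :: ('a \<Rightarrow> real) measure"
  unfolding clocks_def by (intro prob_space_PiM prob_space_uniform_clock)

lemma space_clocks [simp]: "space clocks = UNIV"
  by (simp add: clocks_def space_PiM)

lemma sets_clocks [measurable_cong]: "sets clocks = sets (\<Pi>\<^sub>M i\<in>UNIV. borel)"
  unfolding clocks_def by (intro sets_PiM_cong) auto

lemma measurable_clock [measurable]: "(\<lambda>X. X v) \<in> borel_measurable clocks"
proof -
  have "(\<lambda>X. X v) \<in> measurable (\<Pi>\<^sub>M i\<in>UNIV. borel) borel"
    by (rule measurable_component_singleton) simp
  then show ?thesis by (simp cong: measurable_cong_sets add: sets_clocks)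
qed

lemma measurable_clocksI:
  assumes "\<And>v. (\<lambda>x. f x v) \<in> borel_measurable N"
  shows "f \<in> measurable N clocks"
proof -
  have "f \<in> measurable N (\<Pi>\<^sub>M i\<in>UNIV. borel)"
    by (rule measurable_PiM_single') (use assms in \<open>auto simp: space_PiM\<close>)
  then show ?thesis by (simp cong: measurable_cong_sets add: sets_clocks)
qed

lemma measurable_resample [measurable]:
  "(\<lambda>(s, X). X(v := s)) \<in> measurable (borel \<Otimes>\<^sub>M clocks) clocks"
proof (rule measurable_clocksI)
  fix u
  show "(\<lambda>x. (case x of (s, X) \<Rightarrow> X(v := s)) u) \<in> borel_measurable (borel \<Otimes>\<^sub>M clocks)"
    by (cases "u = v") (auto simp: case_prod_beta)
qed

lemma sets_uniform_clock [measurable_cong]: "sets uniform_clock = sets borel"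
  by simp

text \<open>
  Replacing one coordinate by an independent fresh copy preserves the law.  All conditioning on a
  single arrival time is done through this identity.
\<close>

lemma distr_resample:
  "distr (uniform_clock \<Otimes>\<^sub>M clocks) clocks (\<lambda>(s, X). X(v := s)) = clocks"
  using distr_pair_PiM_eq_PiM[of UNIV "\<lambda>_. uniform_clock" v] prob_space_uniform_clock
  by (simp add: clocks_def)

lemma expectation_resample:
  fixes f :: "('a \<Rightarrow> real) \<Rightarrow> real"
  assumes f [measurable]: "f \<in> borel_measurable clocks" and bound: "\<And>X. 0 \<le> f X" "\<And>X. f X \<le> 1"
  shows "(\<integral>X. f X \<partial>clocks) = (\<integral>s. (\<integral>X. f (X(v := s)) \<partial>clocks) \<partial>uniform_clock)"
    and "(\<integral>X. f X \<partial>clocks) = (\<integral>X. (\<integral>s. f (X(v := s)) \<partial>uniform_clock) \<partial>clocks)"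
proof -
  interpret P: pair_prob_space uniform_clock "clocks :: ('a \<Rightarrow> real) measure" ..
  have m [measurable]: "(\<lambda>(s, X). X(v := s)) \<in> measurable (uniform_clock \<Otimes>\<^sub>M clocks) (clocks :: ('a \<Rightarrow> real) measure)"
    by measurable
  have int: "integrable (uniform_clock \<Otimes>\<^sub>M clocks) (\<lambda>(s, X). f (X(v := s)))"
  proof (rule P.integrable_const_bound[where B = 1])
    show "AE x in uniform_clock \<Otimes>\<^sub>M clocks. norm (case x of (s, X) \<Rightarrow> f (X(v := s))) \<le> 1"
      using bound by (auto simp: case_prod_beta)
    have "(\<lambda>(s, X). f (X(v := s))) = f \<circ> (\<lambda>(s, X). X(v := s))"
      by auto
    then show "(\<lambda>(s, X). f (X(v := s))) \<in> borel_measurable (uniform_clock \<Otimes>\<^sub>M clocks)"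
      using measurable_comp[OF m f] by simp
  qed
  have "(\<integral>X. f X \<partial>clocks) = (\<integral>X. f X \<partial>distr (uniform_clock \<Otimes>\<^sub>M clocks) clocks (\<lambda>(s, X). X(v := s)))"
    by (simp add: distr_resample)
  also have "\<dots> = (\<integral>x. (case x of (s, X) \<Rightarrow> f (X(v := s))) \<partial>(uniform_clock \<Otimes>\<^sub>M clocks))"
    unfolding integral_distr[OF m f] by (simp only: case_prod_beta)
  finally have *: "(\<integral>X. f X \<partial>clocks) = \<dots>" .
  show "(\<integral>X. f X \<partial>clocks) = (\<integral>s. (\<integral>X. f (X(v := s)) \<partial>clocks) \<partial>uniform_clock)"
    using P.integral_fst'[OF int] * by simp
  show "(\<integral>X. f X \<partial>clocks) = (\<integral>X. (\<integral>s. f (X(v := s)) \<partial>uniform_clock) \<partial>clocks)"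
    using P.integral_snd[OF int] * by simp
qed

lemma uniform_clock_eq_density:
  "uniform_clock = density lborel (\<lambda>s. ennreal (indicator {0<..<1} s))"
proof -
  have e: "emeasure lborel {0<..<1::real} = 1" by simp
  have "(\<lambda>s::real. indicator {0<..<1} s / 1 :: ennreal) = (\<lambda>s. ennreal (indicator {0<..<1} s))"
    by (auto simp: divide_ennreal_def indicator_def)
  then show ?thesis unfolding uniform_measure_def e by simp
qed

lemma integral_uniform_clock:
  fixes f :: "real \<Rightarrow> real"
  assumes "f \<in> borel_measurable borel"
  shows "(\<integral>s. f s \<partial>uniform_clock) = (\<integral>s. indicator {0<..<1} s * f s \<partial>lborel)"
proof -
  have "(\<integral>s. f s \<partial>density lborel (\<lambda>s. ennreal (indicator {0<..<1} s)))
      = (\<integral>s. indicator {0<..<1} s *\<^sub>R f s \<partial>lborel)"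
    by (rule integral_density) (use assms in simp_all)
  then show ?thesis by (simp only: uniform_clock_eq_density real_scaleR_def)
qed

lemma integral_uniform_clock_before:
  fixes r :: "real \<Rightarrow> real"
  assumes cont: "continuous_on UNIV r" and t: "0 \<le> t" "t \<le> 1"
  shows "(\<integral>s. (if s < t then r s else 0) \<partial>uniform_clock) = integral {0..t} r"
proof -
  have [measurable]: "r \<in> borel_measurable borel"
    by (rule borel_measurable_continuous_onI) (rule cont)
  have "(\<integral>s. (if s < t then r s else 0) \<partial>uniform_clock)
      = (\<integral>s. indicator {0<..<1} s * (if s < t then r s else 0) \<partial>lborel)"
    by (rule integral_uniform_clock) measurable
  also have "\<dots> = (LINT s:{0<..<t}|lborel. r s)"
    unfolding set_lebesgue_integral_def using t
    by (intro Bochner_Integration.integral_cong) (auto simp: indicator_def)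
  also have "\<dots> = integral {0<..<t} r"
  proof (rule set_borel_integral_eq_integral)
    have "set_integrable lborel {0..t} r"
      by (rule borel_integrable_atLeastAtMost') (rule continuous_on_subset[OF cont], simp)
    then show "set_integrable lborel {0<..<t} r"
      by (rule set_integrable_subset) auto
  qed
  also have "\<dots> = integral {0..t} r"
    by (rule integral_open_interval_real[symmetric])
  finally show ?thesis .
qed

section \<open>Vacancy probabilities and their derivatives\<close>

lemma measurable_occupied [measurable]:
  assumes "finite W"
  shows "Measurable.pred clocks (\<lambda>X. occupied_on_arrival adj W X v)"
  using assms
proof (induction W arbitrary: v rule: finite_psubset_induct)
  case (psubset W)
  show ?case
  proof (cases "v \<in> W")
    case True
    then have [measurable]: "Measurable.pred clocks (\<lambda>X. occupied_on_arrival adj (W - {v}) X w)" for w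
      using psubset.IH[of "W - {v}"] by blast
    have [simp]: "finite (W - {v})" using psubset by simp
    show ?thesis
      unfolding occupied_iff_delete[OF \<open>finite W\<close>, of adj _ v]
      by (intro pred_intros_logic pred_intros_finite) (simp_all add: \<open>finite W\<close>)
  next
    case False
    then show ?thesis
      using occupied_imp_mem[OF \<open>finite W\<close>] by (simp add: occupied_iff[OF \<open>finite W\<close>, of adj _ v])
  qed
qed

lemma measurable_vacant_before [measurable]:
  assumes "finite W" "finite U"
  shows "Measurable.pred clocks (vacant_before adj W U t)"
proof -
  note [measurable] = measurable_occupied[OF assms(1)]
  show ?thesis
    unfolding vacant_before_def[abs_def] using assms(2) by measurable
qed

definition vacancy :: "('a \<Rightarrow> 'a \<Rightarrow> bool) \<Rightarrow> 'a set \<Rightarrow> 'a set \<Rightarrow> real \<Rightarrow> real" where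
  "vacancy adj W U t = measure clocks {X. vacant_before adj W U t X}"

lemma sets_pred_clocks: "Measurable.pred clocks Q \<Longrightarrow> {X. Q X} \<in> sets clocks"
  by (simp add: pred_def)

lemma clock_interval_le:
  assumes "a \<le> b"
  shows "measure clocks {X. a \<le> X v \<and> X v < b} \<le> b - a"
proof -
  have d: "distr clocks uniform_clock (\<lambda>X. X v) = uniform_clock"
    unfolding clocks_def
    by (rule distr_PiM_component) (auto intro: prob_space_uniform_clock)
  have "measure clocks {X. a \<le> X v \<and> X v < b} = measure (distr clocks uniform_clock (\<lambda>X. X v)) {a..<b}"
  proof -
    have m: "(\<lambda>X. X v) \<in> measurable clocks uniform_clock"
      unfolding measurable_cong_sets[OF refl sets_uniform_clock] by (rule measurable_clock)
    have "measure (distr clocks uniform_clock (\<lambda>X. X v)) {a..<b}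
        = measure clocks ((\<lambda>X. X v) -` {a..<b} \<inter> space clocks)"
      by (rule measure_distr[OF m]) simp
    then show ?thesis by (simp only: vimage_def atLeastLessThan_iff space_clocks Int_UNIV_right)
  qed
  also have "\<dots> = measure uniform_clock {a..<b}" by (simp only: d)
  also have "\<dots> = measure lborel ({0<..<1} \<inter> {a..<b})"
    by (simp add: measure_uniform_measure)
  also have "measure lborel ({0<..<1} \<inter> {a..<b}) \<le> measure lborel {a..<b}"
    by (intro measure_mono_fmeasurable fmeasurableI) (simp_all add: assms)
  also have "\<dots> = b - a" using assms by simp
  finally show ?thesis .
qed

lemma vacancy_bounds: "0 \<le> vacancy adj W U t" "vacancy adj W U t \<le> 1"
  by (auto simp: vacancy_def)

lemma vacant_before_earlier:
  "a \<le> b \<Longrightarrow> vacant_before adj W U b X \<Longrightarrow> vacant_before adj W U a X"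
  unfolding vacant_before_def by (meson less_le_trans)

text \<open>
  Between the times \<open>a\<close> and \<open>b\<close> the state of \<open>U\<close> can only change if a site of \<open>U\<close> arrives.
\<close>

lemma vacancy_lipschitz:
  assumes "finite W" "finite U"
  shows "lipschitz_on (real (card U)) UNIV (vacancy adj W U)"
proof (rule lipschitz_onI)
  have *: "\<bar>vacancy adj W U a - vacancy adj W U b\<bar> \<le> card U * (b - a)" if "a \<le> b" for a b :: real
  proof -
    note [measurable] = measurable_vacant_before[OF assms]
    have m: "{X. vacant_before adj W U c X} \<in> sets clocks" for c
      by (rule sets_pred_clocks) measurable
    have i: "{X. a \<le> X u \<and> X u < b} \<in> sets clocks" for u
      by (rule sets_pred_clocks) measurable
    have "vacancy adj W U b \<le> vacancy adj W U a"
      unfolding vacancy_def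
      by (intro clocks.finite_measure_mono m) (use vacant_before_earlier[OF that] in blast)
    moreover have "vacancy adj W U a \<le> vacancy adj W U b + measure clocks (\<Union>u\<in>U. {X. a \<le> X u \<and> X u < b})"
    proof -
      have "vacancy adj W U a \<le> measure clocks ({X. vacant_before adj W U b X} \<union> (\<Union>u\<in>U. {X. a \<le> X u \<and> X u < b}))"
        unfolding vacancy_def using assms
        by (intro clocks.finite_measure_mono sets.Un m sets.finite_UN i) (force simp: vacant_before_def)
      also have "\<dots> \<le> vacancy adj W U b + measure clocks (\<Union>u\<in>U. {X. a \<le> X u \<and> X u < b})"
        unfolding vacancy_def using assms
        by (intro measure_Un_le m sets.finite_UN i)
      finally show ?thesis .
    qed
    moreover have "measure clocks (\<Union>u\<in>U. {X. a \<le> X u \<and> X u < b}) \<le> card U * (b - a)"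
    proof -
      have "measure clocks (\<Union>u\<in>U. {X. a \<le> X u \<and> X u < b}) \<le> (\<Sum>u\<in>U. measure clocks {X. a \<le> X u \<and> X u < b})"
        using assms i by (intro measure_UNION_le) auto
      also have "\<dots> \<le> (\<Sum>u\<in>U. b - a)"
        by (intro sum_mono clock_interval_le that)
      finally show ?thesis by simp
    qed
    ultimately show ?thesis by linarith
  qed
  show "dist (vacancy adj W U a) (vacancy adj W U b) \<le> card U * dist a b" for a b
    using *[of a b] *[of b a] by (cases "a \<le> b") (auto simp: dist_real_def abs_minus_commute)
qed simp

lemma continuous_on_vacancy:
  assumes "finite W" "finite U"
  shows "continuous_on S (vacancy adj W U)"
  using lipschitz_on_continuous_on[OF vacancy_lipschitz[OF assms]]
  by (rule continuous_on_subset) simp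

lemma prob_eq_expectation:
  assumes "Measurable.pred clocks Q"
  shows "measure clocks {X. Q X} = (\<integral>X. of_bool (Q X) \<partial>clocks)"
proof -
  have "(\<lambda>X. of_bool (Q X)) = (indicator {X. Q X} :: _ \<Rightarrow> real)"
    by (auto simp: indicator_def)
  then show ?thesis
    by (simp only: Bochner_Integration.integral_indicator space_clocks Int_UNIV_right)
qed

lemma prob_resample:
  assumes Q [measurable]: "Measurable.pred clocks Q"
  shows "measure clocks {X. Q X} = (\<integral>s. measure clocks {X. Q (X(v := s))} \<partial>uniform_clock)"
proof -
  have Q': "Measurable.pred clocks (\<lambda>X. Q (X(v := s)))" for s
  proof -
    have "(\<lambda>X. X(v := s)) \<in> measurable clocks clocks"
      by (rule measurable_clocksI) (auto simp: fun_upd_apply)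
    then show ?thesis using Q by (rule measurable_compose)
  qed
  have "measure clocks {X. Q X} = (\<integral>X. of_bool (Q X) \<partial>clocks)"
    by (rule prob_eq_expectation) (rule Q)
  also have "\<dots> = (\<integral>s. (\<integral>X. of_bool (Q (X(v := s))) \<partial>clocks) \<partial>uniform_clock)"
    by (rule expectation_resample(1)) auto
  also have "\<dots> = (\<integral>s. measure clocks {X. Q (X(v := s))} \<partial>uniform_clock)"
    by (simp add: prob_eq_expectation[OF Q'])
  finally show ?thesis .
qed

text \<open>
  Conditionally on \<open>w\<close> arriving at time \<open>s\<close>, it becomes occupied iff all its neighbours
  are vacant at that moment in the process from which \<open>w\<close> has been removed.
\<close>

lemma vacancy_eq_integral:
  assumes "finite W" "w \<in> W" "\<And>x. \<not> adj x x" "0 \<le> t" "t \<le> 1"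
  shows "vacancy adj W {w} t = 1 - integral {0..t} (vacancy adj (W - {w}) {u \<in> W. adj w u})"
proof -
  let ?r = "vacancy adj (W - {w}) {u \<in> W. adj w u}"
  have cont: "continuous_on S ?r" for S
    using assms by (intro continuous_on_vacancy) auto
  note [measurable] = measurable_occupied[OF \<open>finite W\<close>] measurable_vacant_before[OF \<open>finite W\<close>]
  have "vacancy adj W {w} t = measure clocks (space clocks - {X. occupied_on_arrival adj W X w \<and> X w < t})"
    unfolding vacancy_def vacant_before_def by (rule arg_cong[where f = "measure clocks"]) auto
  also have "\<dots> = 1 - measure clocks {X. occupied_on_arrival adj W X w \<and> X w < t}"
    by (rule clocks.prob_compl, rule sets_pred_clocks) measurable
  also have "measure clocks {X. occupied_on_arrival adj W X w \<and> X w < t}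
      = (\<integral>s. measure clocks {X. occupied_on_arrival adj W (X(w := s)) w \<and> (X(w := s)) w < t} \<partial>uniform_clock)"
    by (rule prob_resample) measurable
  also have "\<dots> = (\<integral>s. (if s < t then ?r s else 0) \<partial>uniform_clock)"
    using assms by (intro Bochner_Integration.integral_cong)
      (auto simp: vacancy_def vacant_before_at_arrival)
  also have "\<dots> = integral {0..t} ?r"
    by (rule integral_uniform_clock_before[OF cont]) (use assms in auto)
  finally show ?thesis .
qed

lemma vacancy_has_derivative:
  assumes "finite W" "w \<in> W" "\<And>x. \<not> adj x x" "0 < t" "t < 1"
  shows "(vacancy adj W {w} has_real_derivative - vacancy adj (W - {w}) {u \<in> W. adj w u} t) (at t)"
proof -
  let ?r = "vacancy adj (W - {w}) {u \<in> W. adj w u}"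
  have cont: "continuous_on S ?r" for S
    using assms by (intro continuous_on_vacancy) auto
  have "((\<lambda>x. integral {0..x} ?r) has_real_derivative ?r t) (at t within {0..1})"
    by (rule integral_has_real_derivative[OF cont]) (use assms in auto)
  then have "((\<lambda>x. 1 - integral {0..x} ?r) has_real_derivative - ?r t) (at t within {0..1})"
    by (auto intro!: derivative_eq_intros)
  then have "(vacancy adj W {w} has_real_derivative - ?r t) (at t within {0..1})"
    by (rule has_field_derivative_transform_within[where d = 1])
       (use assms in \<open>auto simp: vacancy_eq_integral\<close>)
  moreover have "at t within {0..1} = at t"
    using assms by (intro at_within_interior) auto
  ultimately show ?thesis by simp
qed

lemma vacancy_0:
  assumes "finite W" "w \<in> W" "\<And>x. \<not> adj x x"
  shows "vacancy adj W {w} 0 = 1"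
  using vacancy_eq_integral[where adj = adj, OF assms, where t = 0] by simp

section \<open>Positive correlation of vacancies\<close>

lemma prob_clocks_UNIV [simp]: "measure clocks UNIV = 1"
  using clocks.prob_space by simp

text \<open>
  The integral of \<open>(f x - f y) * (g x - g y)\<close> over two independent copies \<open>x\<close>, \<open>y\<close> is twice
  the covariance of \<open>f\<close> and \<open>g\<close>.
\<close>

lemma (in prob_space) chebyshev_comonotone:
  fixes f g :: "'a \<Rightarrow> real"
  assumes [measurable]: "f \<in> borel_measurable M" "g \<in> borel_measurable M"
    and f: "\<And>x. 0 \<le> f x" "\<And>x. f x \<le> 1" and g: "\<And>x. 0 \<le> g x" "\<And>x. g x \<le> 1"
    and comonotone: "\<And>x y. 0 \<le> (f x - f y) * (g x - g y)"
  shows "expectation f * expectation g \<le> expectation (\<lambda>x. f x * g x)"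
proof -
  have If: "integrable M f" and Ig: "integrable M g"
    using f g by (auto intro!: integrable_const_bound[where B = 1])
  have Ifg: "integrable M (\<lambda>x. f x * g x)"
    using f g by (intro integrable_const_bound[where B = 1])
      (auto intro!: AE_I2 mult_le_one simp: abs_mult)
  define F G H where "F = expectation f" and "G = expectation g" and "H = expectation (\<lambda>x. f x * g x)"
  have "0 \<le> f x * g x - f x * G - F * g x + H" for x
  proof -
    have "0 \<le> expectation (\<lambda>y. (f x - f y) * (g x - g y))"
      using comonotone by (intro Bochner_Integration.integral_nonneg)
    also have "\<dots> = expectation (\<lambda>y. f x * g x - f x * g y - f y * g x + f y * g y)"
      by (intro Bochner_Integration.integral_cong) (auto simp: algebra_simps)
    also have "\<dots> = f x * g x - f x * G - F * g x + H"
      using If Ig Ifg by (simp add: F_def G_def H_def prob_space)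
    finally show ?thesis .
  qed
  then have "0 \<le> expectation (\<lambda>x. f x * g x - f x * G - F * g x + H)"
    by (intro Bochner_Integration.integral_nonneg)
  also have "\<dots> = H - F * G - F * G + H"
    using If Ig Ifg by (simp add: F_def G_def H_def prob_space)
  finally show ?thesis by (simp add: F_def G_def H_def)
qed

lemma tilted_le_fun_upd: "tilted_le A X Y \<Longrightarrow> tilted_le A (X(v := s)) (Y(v := s))"
  by (auto simp: tilted_le_def)

lemma tilted_le_upd_cases:
  "tilted_le A (X(v := s)) (X(v := s')) \<or> tilted_le A (X(v := s')) (X(v := s))"
  by (cases "v \<in> A"; cases "s \<le> s'") (auto simp: tilted_le_def)

text \<open>
  Integrate out one coordinate \<open>v\<close> at a time.  As functions of that coordinate alone, \<open>f\<close> and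
  \<open>g\<close> are both decreasing (if \<open>v\<close> is in \<open>A\<close>) or both increasing, so the average of the
  product dominates the product of the averages \<open>F\<close> and \<open>G\<close>; these are again monotone and
  depend on one coordinate less.
\<close>

lemma harris_inequality:
  fixes f g :: "('a \<Rightarrow> real) \<Rightarrow> real"
  assumes "finite W"
    and "f \<in> borel_measurable clocks" "g \<in> borel_measurable clocks"
    and "\<And>X. 0 \<le> f X" "\<And>X. f X \<le> 1" "\<And>X. 0 \<le> g X" "\<And>X. g X \<le> 1"
    and "\<And>X Y. tilted_le A X Y \<Longrightarrow> f X \<le> f Y" "\<And>X Y. tilted_le A X Y \<Longrightarrow> g X \<le> g Y"
    and "\<And>X Y. (\<And>w. w \<in> W \<Longrightarrow> X w = Y w) \<Longrightarrow> f X = f Y"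
    and "\<And>X Y. (\<And>w. w \<in> W \<Longrightarrow> X w = Y w) \<Longrightarrow> g X = g Y"
  shows "(\<integral>X. f X \<partial>clocks) * (\<integral>X. g X \<partial>clocks) \<le> (\<integral>X. f X * g X \<partial>clocks)"
  using assms
proof (induction W arbitrary: f g rule: finite_induct)
  case empty
  have "f = (\<lambda>_. f (\<lambda>_. 0))" "g = (\<lambda>_. g (\<lambda>_. 0))"
    using empty.prems(9,10) by blast+
  then obtain a b where "f = (\<lambda>_. a)" "g = (\<lambda>_. b)" by blast
  then show ?case by (simp add: clocks.prob_space)
next
  case (insert v W)
  note f = insert.prems(1) and g = insert.prems(2)
  have upd: "(\<lambda>s. X(v := s)) \<in> measurable uniform_clock clocks" for X :: "'a \<Rightarrow> real"
  proof (rule measurable_clocksI)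
    show "(\<lambda>s. (X(v := s)) u) \<in> borel_measurable uniform_clock" for u
      by (cases "u = v") (auto intro: measurable_ident_sets)
  qed
  have sec [measurable]: "(\<lambda>s. h (X(v := s))) \<in> borel_measurable uniform_clock"
    if "h \<in> borel_measurable clocks" for h :: "('a \<Rightarrow> real) \<Rightarrow> real" and X
    using upd that by (rule measurable_compose)
  have sec_int: "integrable uniform_clock (\<lambda>s. h (X(v := s)))"
    if "h \<in> borel_measurable clocks" "\<And>X. 0 \<le> h X" "\<And>X. h X \<le> 1"
    for h :: "('a \<Rightarrow> real) \<Rightarrow> real" and X
    using that sec by (intro uniform_clock.integrable_const_bound[where B = 1]) auto
  have meas: "(\<lambda>X. \<integral>s. h (X(v := s)) \<partial>uniform_clock) \<in> borel_measurable clocks"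
    if h: "h \<in> borel_measurable clocks" for h :: "('a \<Rightarrow> real) \<Rightarrow> real"
  proof (rule uniform_clock.borel_measurable_lebesgue_integral)
    have "(\<lambda>p. (fst p)(v := snd p)) \<in> measurable (clocks \<Otimes>\<^sub>M uniform_clock) clocks"
    proof (rule measurable_clocksI)
      show "(\<lambda>p. ((fst p)(v := snd p)) u) \<in> borel_measurable (clocks \<Otimes>\<^sub>M uniform_clock)" for u
        by (cases "u = v") auto
    qed
    then have "(\<lambda>p. h ((fst p)(v := snd p))) \<in> borel_measurable (clocks \<Otimes>\<^sub>M uniform_clock)"
      using h by (rule measurable_compose)
    then show "(\<lambda>(X, s). h (X(v := s))) \<in> borel_measurable (clocks \<Otimes>\<^sub>M uniform_clock)"
      unfolding split_beta' .
  qed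
  have avg01: "0 \<le> (\<integral>s. h (X(v := s)) \<partial>uniform_clock)" "(\<integral>s. h (X(v := s)) \<partial>uniform_clock) \<le> 1"
    if "h \<in> borel_measurable clocks" "\<And>X. 0 \<le> h X" "\<And>X. h X \<le> 1"
    for h :: "('a \<Rightarrow> real) \<Rightarrow> real" and X
  proof -
    show "0 \<le> (\<integral>s. h (X(v := s)) \<partial>uniform_clock)"
      by (intro Bochner_Integration.integral_nonneg that(2))
    show "(\<integral>s. h (X(v := s)) \<partial>uniform_clock) \<le> 1"
      by (intro uniform_clock.integral_le_const sec_int that AE_I2)
  qed
  define F G where "F X = (\<integral>s. f (X(v := s)) \<partial>uniform_clock)"
    and "G X = (\<integral>s. g (X(v := s)) \<partial>uniform_clock)" for X
  have F01: "0 \<le> F X" "F X \<le> 1" for X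
    unfolding F_def by (intro avg01 f insert.prems(3,4))+
  have G01: "0 \<le> G X" "G X \<le> 1" for X
    unfolding G_def by (intro avg01 g insert.prems(5,6))+
  have F: "F \<in> borel_measurable clocks" and G: "G \<in> borel_measurable clocks"
    unfolding F_def[abs_def] G_def[abs_def] by (intro meas f g)+
  have fg01: "0 \<le> f X * g X" "f X * g X \<le> 1" for X
    by (intro mult_nonneg_nonneg mult_le_one insert.prems(3-6))+
  have fg: "(\<lambda>X. f X * g X) \<in> borel_measurable clocks"
    using f g by (rule borel_measurable_times)
  have FG: "F X * G X \<le> (\<integral>s. f (X(v := s)) * g (X(v := s)) \<partial>uniform_clock)" for X
    unfolding F_def G_def
  proof (rule uniform_clock.chebyshev_comonotone)
    show "0 \<le> (f (X(v := s)) - f (X(v := s'))) * (g (X(v := s)) - g (X(v := s')))" for s s'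
      using tilted_le_upd_cases[of A X v s s'] insert.prems(7,8)
      by (auto simp: zero_le_mult_iff)
  qed (rule sec[OF f] sec[OF g] insert.prems(3-6))+
  have "(\<integral>X. f X \<partial>clocks) * (\<integral>X. g X \<partial>clocks) = (\<integral>X. F X \<partial>clocks) * (\<integral>X. G X \<partial>clocks)"
    unfolding F_def G_def
    by (intro arg_cong2[where f = "(*)"] expectation_resample(2) f g insert.prems(3-6))
  also have "\<dots> \<le> (\<integral>X. F X * G X \<partial>clocks)"
  proof (rule insert.IH)
    show "F X \<le> F Y" if "tilted_le A X Y" for X Y
      unfolding F_def by (intro integral_mono sec_int f insert.prems tilted_le_fun_upd that)
    show "G X \<le> G Y" if "tilted_le A X Y" for X Y
      unfolding G_def by (intro integral_mono sec_int g insert.prems tilted_le_fun_upd that)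
    show "F X = F Y" if "\<And>w. w \<in> W \<Longrightarrow> X w = Y w" for X Y
      unfolding F_def using that
      by (intro Bochner_Integration.integral_cong refl insert.prems(9)) auto
    show "G X = G Y" if "\<And>w. w \<in> W \<Longrightarrow> X w = Y w" for X Y
      unfolding G_def using that
      by (intro Bochner_Integration.integral_cong refl insert.prems(10)) auto
  qed (rule F G F01 G01)+
  also have "\<dots> \<le> (\<integral>X. (\<integral>s. f (X(v := s)) * g (X(v := s)) \<partial>uniform_clock) \<partial>clocks)"
  proof (rule integral_mono[OF _ _ FG])
    show "integrable clocks (\<lambda>X. F X * G X)"
    proof (rule clocks.integrable_const_bound[where B = 1])
      show "(\<lambda>X. F X * G X) \<in> borel_measurable clocks" using F G by measurable
      show "AE X in clocks. norm (F X * G X) \<le> 1"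
        using F01 G01 by (intro AE_I2) (simp add: abs_mult mult_le_one)
    qed
    show "integrable clocks (\<lambda>X. \<integral>s. f (X(v := s)) * g (X(v := s)) \<partial>uniform_clock)"
    proof (rule clocks.integrable_const_bound[where B = 1, OF AE_I2 meas[OF fg]])
      show "norm (\<integral>s. f (X(v := s)) * g (X(v := s)) \<partial>uniform_clock) \<le> 1" for X
        using avg01[OF fg fg01, of X] by (simp only: real_norm_def abs_of_nonneg)
    qed
  qed
  also have "\<dots> = (\<integral>X. f X * g X \<partial>clocks)"
    by (rule expectation_resample(2)[OF fg fg01, symmetric])
  finally show ?case .
qed

context two_coloured_graph
begin

text \<open>
  Vacancy of sites off \<open>A\<close> is increasing for the tilted order.  The two events may concern
  different subgraphs.
\<close>

lemma vacancies_positively_correlated: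
  assumes fin: "finite W" "finite W'" "finite U" "finite U'" and U: "U \<inter> A = {}" "U' \<inter> A = {}"
  shows "vacancy adj W U s * vacancy adj W' U' s
    \<le> measure clocks {X. vacant_before adj W U s X \<and> vacant_before adj W' U' s X}"
proof -
  note [measurable] = measurable_vacant_before[OF fin(1,3)] measurable_vacant_before[OF fin(2,4)]
  have "vacancy adj W U s * vacancy adj W' U' s
      = (\<integral>X. of_bool (vacant_before adj W U s X) \<partial>clocks) * (\<integral>X. of_bool (vacant_before adj W' U' s X) \<partial>clocks)"
    unfolding vacancy_def by (subst (1 2) prob_eq_expectation) simp_all
  also have "\<dots> \<le> (\<integral>X. of_bool (vacant_before adj W U s X) * of_bool (vacant_before adj W' U' s X) \<partial>clocks)"
  proof (rule harris_inequality[where W = "W \<union> W'" and A = A])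
    show "of_bool (vacant_before adj W U s X) \<le> (of_bool (vacant_before adj W U s Y) :: real)"
      if "tilted_le A X Y" for X Y
      using vacant_before_mono[OF fin(1,1) _ _ that U(1)] by auto
    show "of_bool (vacant_before adj W' U' s X) \<le> (of_bool (vacant_before adj W' U' s Y) :: real)"
      if "tilted_le A X Y" for X Y
      using vacant_before_mono[OF fin(2,2) _ _ that U(2)] by auto
    show "of_bool (vacant_before adj W U s X) = (of_bool (vacant_before adj W U s Y) :: real)"
      if "\<And>w. w \<in> W \<union> W' \<Longrightarrow> X w = Y w" for X Y
      using vacant_before_cong[OF fin(1), of X Y adj U s] that by auto
    show "of_bool (vacant_before adj W' U' s X) = (of_bool (vacant_before adj W' U' s Y) :: real)"
      if "\<And>w. w \<in> W \<union> W' \<Longrightarrow> X w = Y w" for X Y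
      using vacant_before_cong[OF fin(2), of X Y adj U' s] that by auto
  qed (use fin in \<open>auto\<close>)
  also have "\<dots> = measure clocks {X. vacant_before adj W U s X \<and> vacant_before adj W' U' s X}"
    by (subst prob_eq_expectation) (simp_all add: of_bool_conj)
  finally show ?thesis .
qed

lemma vacancy_ge_prod:
  assumes "finite W" "finite U" "U \<inter> A = {}"
  shows "(\<Prod>u\<in>U. vacancy adj W {u} s) \<le> vacancy adj W U s"
  using assms(2,3)
proof (induction U rule: finite_induct)
  case empty
  then show ?case by (simp add: vacancy_def vacant_before_def )
next
  case (insert u U)
  have "(\<Prod>x\<in>insert u U. vacancy adj W {x} s) = vacancy adj W {u} s * (\<Prod>x\<in>U. vacancy adj W {x} s)"
    using insert by simp
  also have "\<dots> \<le> vacancy adj W {u} s * vacancy adj W U s"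
    using insert by (intro mult_left_mono vacancy_bounds) auto
  also have "\<dots> \<le> measure clocks {X. vacant_before adj W {u} s X \<and> vacant_before adj W U s X}"
    using insert assms by (intro vacancies_positively_correlated) auto
  also have "\<dots> = vacancy adj W (insert u U) s"
    unfolding vacancy_def by (auto intro!: arg_cong[where f = "measure clocks"] simp: vacant_before_def)
  finally show ?case .
qed

text \<open>
  Deleting a site means postponing its arrival forever, which can only harm its own colour class.
\<close>

lemma vacancy_delete_same_colour:
  assumes "finite W" "finite U" "U \<inter> A = {}" "v \<notin> A"
  shows "vacancy adj W U s \<le> vacancy adj (W - {v}) U s"
  unfolding vacancy_def
proof (rule clocks.finite_measure_mono)
  show "{X. vacant_before adj (W - {v}) U s X} \<in> sets clocks"
    using assms by (intro sets_pred_clocks measurable_vacant_before) auto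
  show "{X. vacant_before adj W U s X} \<subseteq> {X. vacant_before adj (W - {v}) U s X}"
    using assms vacant_before_mono[of W "W - {v}" _ _ U s] by (auto simp: tilted_le_def)
qed

end

section \<open>Inequalities for finite bipartite graphs\<close>

context two_coloured_graph
begin

text \<open>
  Given that \<open>w\<close> is still vacant, the other neighbours of \<open>v\<close> have evolved as in the process
  without \<open>w\<close>.  The event that \<open>w\<close> is vacant and the event that these neighbours are vacant in
  the process without \<open>w\<close> concern sites of one colour, so they are positively correlated.
\<close>

lemma vacancy_neighbours_ge:
  assumes fin: "finite W" and vw: "v \<in> W" "w \<in> W" "adj v w"
  shows "vacancy adj (W - {v}) {w} s * vacancy adj (W - {v} - {w}) {u \<in> W - {w}. adj v u} s
    \<le> vacancy adj (W - {v}) {u \<in> W. adj v u} s"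
proof -
  let ?N = "{u \<in> W. adj v u}"
  have N: "{u \<in> W - {w}. adj v u} = ?N - {w}" by auto
  have corr: "vacancy adj (W - {v}) {w} s * vacancy adj (W - {v} - {w}) (?N - {w}) s
    \<le> measure clocks {X. vacant_before adj (W - {v}) {w} s X \<and> vacant_before adj (W - {v} - {w}) (?N - {w}) s X}"
  proof (cases "v \<in> A")
    case True
    then have "?N \<inter> A = {}" using adj_cross by blast
    then show ?thesis
      using fin vw by (intro vacancies_positively_correlated) auto
  next
    case False
    then have "?N \<inter> - A = {}" using adj_cross by blast
    then show ?thesis
      using fin vw by (intro two_coloured_graph.vacancies_positively_correlated[OF swap_colours]) auto
  qed
  have "w \<in> ?N" using vw by auto
  have split: "vacant_before adj (W - {v}) ?N s X \<longleftrightarrow>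
      vacant_before adj (W - {v}) {w} s X \<and> vacant_before adj (W - {v} - {w}) (?N - {w}) s X" for X
    using fin \<open>w \<in> ?N\<close> by (intro vacant_before_split) auto
  show ?thesis
    unfolding N using corr by (simp only: vacancy_def[of adj "W - {v}" ?N] split)
qed

text \<open>
  The right-hand side is the rate at which the vacancy of \<open>w\<close> in the graph without \<open>v\<close> decreases.
  Positive correlation decouples the neighbours of \<open>w\<close>, and then \<open>v\<close> can be put back, because it
  has the same colour as they do.
\<close>

lemma cavity_vacancy_ge:
  assumes fin: "finite W" and vw: "v \<in> W" "w \<in> W" "adj w v"
  shows "(\<Prod>u\<in>{u \<in> W - {v}. adj w u}. vacancy adj (W - {w}) {u} s)
    \<le> vacancy adj (W - {v} - {w}) {u \<in> W - {v}. adj w u} s"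
proof -
  let ?N = "{u \<in> W - {v}. adj w u}"
  have W: "W - {v} - {w} = W - {w} - {v}" by auto
  have fin': "finite (W - {w} - {v})" "finite (W - {w})" "finite ?N" using fin by auto
  show ?thesis
  proof (cases "w \<in> A")
    case True
    then have N: "?N \<inter> A = {}" and v: "v \<notin> A" using adj_cross vw(3) by blast+
    have "(\<Prod>u\<in>?N. vacancy adj (W - {w}) {u} s) \<le> (\<Prod>u\<in>?N. vacancy adj (W - {w} - {v}) {u} s)"
      using N v fin' by (intro prod_mono conjI vacancy_bounds vacancy_delete_same_colour) auto
    also have "\<dots> \<le> vacancy adj (W - {w} - {v}) ?N s"
      using N fin' by (intro vacancy_ge_prod) auto
    finally show ?thesis by (simp only: W)
  next
    case False
    interpret B: two_coloured_graph adj "- A" by (rule swap_colours)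
    have N: "?N \<inter> - A = {}" and v: "v \<notin> - A" using adj_cross vw(3) False by blast+
    have "(\<Prod>u\<in>?N. vacancy adj (W - {w}) {u} s) \<le> (\<Prod>u\<in>?N. vacancy adj (W - {w} - {v}) {u} s)"
      using N v fin' by (intro prod_mono conjI vacancy_bounds B.vacancy_delete_same_colour) auto
    also have "\<dots> \<le> vacancy adj (W - {w} - {v}) ?N s"
      using N fin' by (intro B.vacancy_ge_prod) auto
    finally show ?thesis by (simp only: W)
  qed
qed

text \<open>
  Both sides equal 1 at time 0.  The left-hand side decreases at rate \<open>r1 + r2\<close>, where the \<open>r\<close>s
  are the probabilities that all neighbours of \<open>v\<close> (of \<open>w\<close>) are vacant without \<open>v\<close> (\<open>w\<close>);
  the right-hand side \<open>b1 * b2\<close> decreases at rate \<open>b1 * d2 + b2 * d1\<close>, which is at most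
  \<open>r1 + r2\<close> by \<open>vacancy_neighbours_ge\<close>.
\<close>

lemma vacancy_pair_le:
  assumes fin: "finite W" and vw: "v \<in> W" "w \<in> W" "adj v w" "adj w v" and t: "0 \<le> t" "t \<le> 1"
  shows "vacancy adj W {v} t + vacancy adj W {w} t - 1
    \<le> vacancy adj (W - {v}) {w} t * vacancy adj (W - {w}) {v} t"
proof -
  have "v \<noteq> w" using irrefl vw by auto
  define b1 where "b1 = vacancy adj (W - {v}) {w}"
  define b2 where "b2 = vacancy adj (W - {w}) {v}"
  \<comment> \<open>the difference of the two sides, to be shown nonnegative\<close>
  define h where "h s = b1 s * b2 s - (vacancy adj W {v} s + vacancy adj W {w} s - 1)" for s
  have "h 0 \<le> h t"
  proof (rule DERIV_nonneg_imp_increasing_open[OF \<open>0 \<le> t\<close>])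
    fix s assume "0 < s" "s < t"
    then have s: "0 < s" "s < 1" using t by auto
    define d1 where "d1 = vacancy adj (W - {v} - {w}) {u \<in> W - {v}. adj w u} s"
    define d2 where "d2 = vacancy adj (W - {w} - {v}) {u \<in> W - {w}. adj v u} s"
    define r1 where "r1 = vacancy adj (W - {v}) {u \<in> W. adj v u} s"
    define r2 where "r2 = vacancy adj (W - {w}) {u \<in> W. adj w u} s"
    have "W - {w} - {v} = W - {v} - {w}" by auto
    then have "b1 s * d2 \<le> r1"
      using vacancy_neighbours_ge[OF fin vw(1,2,3), of s] by (simp add: b1_def d2_def r1_def)
    moreover have "W - {w} - {v} = W - {v} - {w}" by auto
    then have "b2 s * d1 \<le> r2"
      using vacancy_neighbours_ge[OF fin vw(2,1,4), of s] by (simp add: b2_def d1_def r2_def)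
    moreover have "(h has_real_derivative (- d1 * b2 s + - d2 * b1 s) - (- r1 + - r2 - 0)) (at s)"
      unfolding h_def[abs_def]
    proof (intro derivative_intros)
      show "(b1 has_real_derivative - d1) (at s)" unfolding b1_def d1_def
        using fin vw s \<open>v \<noteq> w\<close> irrefl by (intro vacancy_has_derivative) auto
      show "(b2 has_real_derivative - d2) (at s)" unfolding b2_def d2_def
        using fin vw s \<open>v \<noteq> w\<close> irrefl by (intro vacancy_has_derivative) auto
      show "(vacancy adj W {v} has_real_derivative - r1) (at s)" unfolding r1_def
        using fin vw s irrefl by (intro vacancy_has_derivative) auto
      show "(vacancy adj W {w} has_real_derivative - r2) (at s)" unfolding r2_def
        using fin vw s irrefl by (intro vacancy_has_derivative) auto
    qed
    ultimately show "\<exists>y. (h has_real_derivative y) (at s) \<and> y \<ge> 0"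
      by (intro exI conjI) (auto simp: algebra_simps)
  next
    show "continuous_on {0..t} h"
      unfolding h_def[abs_def] b1_def b2_def using fin
      by (intro continuous_intros continuous_on_vacancy) auto
  qed
  moreover have "h 0 = 0"
    using fin vw \<open>v \<noteq> w\<close> irrefl by (simp add: h_def b1_def b2_def vacancy_0)
  ultimately show ?thesis by (simp add: h_def b1_def b2_def)
qed

end

section \<open>Locality along descending paths\<close>

primrec ball_of_radius :: "('a \<Rightarrow> 'a \<Rightarrow> bool) \<Rightarrow> nat \<Rightarrow> 'a \<Rightarrow> 'a set" where
  "ball_of_radius adj 0 v = {v}"
| "ball_of_radius adj (Suc n) v = insert v (\<Union>w\<in>{w. adj v w}. ball_of_radius adj n w)"

primrec descending_path :: "('a \<Rightarrow> 'a \<Rightarrow> bool) \<Rightarrow> nat \<Rightarrow> ('a \<Rightarrow> real) \<Rightarrow> 'a \<Rightarrow> bool" where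
  "descending_path adj 0 X v \<longleftrightarrow> True"
| "descending_path adj (Suc n) X v \<longleftrightarrow> (\<exists>w\<in>{w. adj v w}. X w < X v \<and> descending_path adj n X w)"

lemma centre_in_ball: "v \<in> ball_of_radius adj n v"
  by (cases n) auto

lemma ball_mono_Suc: "ball_of_radius adj n v \<subseteq> ball_of_radius adj (Suc n) v"
proof (induction n arbitrary: v)
  case (Suc n)
  have "(\<Union>w\<in>{w. adj v w}. ball_of_radius adj n w) \<subseteq> (\<Union>w\<in>{w. adj v w}. ball_of_radius adj (Suc n) w)"
    using Suc.IH by (intro UN_mono) auto
  then show ?case
    unfolding ball_of_radius.simps(2)[of adj n] ball_of_radius.simps(2)[of adj "Suc n"] by blast
qed simp

lemma ball_neighbour: "adj v w \<Longrightarrow> ball_of_radius adj n w \<subseteq> ball_of_radius adj (Suc n) v"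
  by auto

lemma finite_ball:
  assumes "\<And>x. finite {y. adj x y}"
  shows "finite (ball_of_radius adj n v)"
  using assms by (induction n arbitrary: v) auto

lemma ball_subset:
  assumes "\<And>x y. adj x y \<Longrightarrow> y \<in> V" "v \<in> V"
  shows "ball_of_radius adj n v \<subseteq> V"
  using assms(2)
proof (induction n arbitrary: v)
  case (Suc n)
  then show ?case using assms(1) by auto
qed simp

text \<open>
  The state of \<open>v\<close> can only be influenced along paths with decreasing arrival times.
\<close>

lemma occupied_local:
  assumes fin: "finite W" "finite W'"
    and "\<not> descending_path adj n X v"
    and "\<And>u. u \<in> ball_of_radius adj n v \<Longrightarrow> u \<in> W \<longleftrightarrow> u \<in> W'"
  shows "occupied_on_arrival adj W X v \<longleftrightarrow> occupied_on_arrival adj W' X v"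
  using assms(3,4)
proof (induction n arbitrary: v)
  case (Suc n)
  have "occupied_on_arrival adj W X w \<longleftrightarrow> occupied_on_arrival adj W' X w"
    if "adj v w" "X w < X v" for w
    using that Suc.prems by (intro Suc.IH) auto
  moreover have "w \<in> W \<longleftrightarrow> w \<in> W'" if "adj v w" for w
    using that Suc.prems(2)[of w] centre_in_ball[of w adj n] by auto
  moreover have "v \<in> W \<longleftrightarrow> v \<in> W'"
    using Suc.prems(2)[of v] by simp
  ultimately show ?case
    unfolding occupied_iff[OF fin(1), of adj X v] occupied_iff[OF fin(2), of adj X v] by blast
qed simp

lemma descending_path_cong:
  assumes "\<And>u. u \<in> ball_of_radius adj n v \<Longrightarrow> X u = Y u"
  shows "descending_path adj n X v = descending_path adj n Y v"
  using assms
proof (induction n arbitrary: v)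
  case (Suc n)
  have "descending_path adj n X w = descending_path adj n Y w" if "adj v w" for w
    using that Suc.prems by (intro Suc.IH) auto
  moreover have "X w = Y w" if "adj v w" for w
    using that Suc.prems[of w] centre_in_ball[of w adj n] by auto
  moreover have "X v = Y v" using Suc.prems[of v] by simp
  ultimately show ?case by auto
qed simp

text \<open>
  A descending path that starts below the value at \<open>v\<close> never visits \<open>v\<close>.
\<close>

lemma descending_path_avoids_later:
  assumes "descending_path adj n (X(v := s)) w" "w \<noteq> v" "X w < s"
  shows "descending_path adj n X w"
  using assms
proof (induction n arbitrary: w)
  case (Suc n)
  from \<open>w \<noteq> v\<close> have "(X(v := s)) w = X w" by simp
  with Suc.prems(1) obtain u where u: "adj w u" "(X(v := s)) u < X w" "descending_path adj n (X(v := s)) u"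
    unfolding descending_path.simps by force
  from Suc.prems(3) u(2) have "u \<noteq> v" by auto
  then have "X u < X w" using u(2) by simp
  with Suc.prems(3) have "descending_path adj n X u"
    by (intro Suc.IH[OF u(3) \<open>u \<noteq> v\<close>]) simp
  with \<open>X u < X w\<close> u(1) show ?case by auto
qed simp

lemma measurable_descending_path [measurable]:
  assumes fin: "\<And>x. finite {y. adj x y}"
  shows "Measurable.pred clocks (\<lambda>X. descending_path adj n X v)"
proof (induction n arbitrary: v)
  case (Suc n)
  note [measurable] = Suc.IH
  show ?case
    unfolding descending_path.simps
    by (rule pred_intros_finite(4)[OF fin]) measurable
qed simp

lemma AE_uniform_clock: "(\<And>s. 0 < s \<Longrightarrow> s < 1 \<Longrightarrow> P s) \<Longrightarrow> AE s in uniform_clock. P s"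
  by (rule AE_uniform_measureI) auto

lemma integral_power_before:
  fixes c :: real
  assumes "0 \<le> t" "t \<le> 1"
  shows "(\<integral>s. (if s < t then c * s ^ n else 0) \<partial>uniform_clock) = c * t ^ Suc n / Suc n"
proof -
  have "((\<lambda>s. c / Suc n * s ^ Suc n) has_real_derivative c / Suc n * (real (Suc n) * x ^ (Suc n - Suc 0)))
      (at x within {0..t})" for x
    by (rule DERIV_cmult[OF DERIV_pow])
  then have int: "((\<lambda>s. c * s ^ n) has_integral c / Suc n * t ^ Suc n - c / Suc n * 0 ^ Suc n) {0..t}"
    by (intro fundamental_theorem_of_calculus)
       (use assms in \<open>simp_all add: has_real_derivative_iff_has_vector_derivative[symmetric]\<close>)
  have "(\<integral>s. (if s < t then c * s ^ n else 0) \<partial>uniform_clock) = integral {0..t} (\<lambda>s. c * s ^ n)"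
    by (intro integral_uniform_clock_before continuous_intros assms)
  then show ?thesis unfolding integral_unique[OF int] by simp
qed

lemma prob_clock_less:
  assumes "0 \<le> t" "t \<le> 1"
  shows "measure clocks {X. X v < t} = t"
proof -
  have "measure clocks {X. X v < t} = (\<integral>s. measure clocks {X :: 'a \<Rightarrow> real. (X(v := s)) v < t} \<partial>uniform_clock)"
    by (rule prob_resample) measurable
  also have "\<dots> = (\<integral>s. (if s < t then 1 * s ^ 0 else 0) \<partial>uniform_clock)"
    by (intro Bochner_Integration.integral_cong) auto
  also have "\<dots> = t" using assms by (subst integral_power_before) auto
  finally show ?thesis .
qed

text \<open>
  A fixed self-avoiding path of length \<open>n\<close> is descending with probability \<open>1 / (n + 1)!\<close>, and
  there are at most \<open>C ^ n\<close> paths.  The bound with the start before \<open>t\<close> follows by induction,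
  conditioning on the first arrival time.
\<close>

lemma prob_descending_path_before_le:
  assumes fin: "\<And>x. finite {y. adj x y}" and deg: "\<And>x. card {y. adj x y} \<le> C"
    and "0 \<le> t" "t \<le> 1"
  shows "measure clocks {X. descending_path adj n X v \<and> X v < t} \<le> real C ^ n * t ^ Suc n / fact (Suc n)"
  using assms(3,4)
proof (induction n arbitrary: v t)
  case 0
  then show ?case by (simp add: prob_clock_less)
next
  case (Suc n)
  note [measurable] = measurable_descending_path[OF fin]
  have sets: "{X. descending_path adj m X w \<and> X w < s} \<in> sets clocks" for m w s
    by (rule sets_pred_clocks) measurable
  \<comment> \<open>the bound for one step: at most \<open>C\<close> choices for the next vertex\<close>
  define K where "K = real C * real C ^ n / fact (Suc n)"
  have bound: "measure clocks {X. descending_path adj (Suc n) (X(v := s)) v \<and> (X(v := s)) v < t}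
      \<le> (if s < t then K * s ^ Suc n else 0)" if "0 < s" "s < 1" for s
  proof (cases "s < t")
    case True
    have "measure clocks {X. descending_path adj (Suc n) (X(v := s)) v \<and> (X(v := s)) v < t}
        \<le> measure clocks (\<Union>w\<in>{w. adj v w}. {X. descending_path adj n X w \<and> X w < s})"
    proof (rule clocks.finite_measure_mono)
      show "(\<Union>w\<in>{w. adj v w}. {X. descending_path adj n X w \<and> X w < s}) \<in> sets clocks"
        using fin sets by (intro sets.finite_UN) auto
      show "{X. descending_path adj (Suc n) (X(v := s)) v \<and> (X(v := s)) v < t}
          \<subseteq> (\<Union>w\<in>{w. adj v w}. {X. descending_path adj n X w \<and> X w < s})"
      proof safe
        fix X assume "descending_path adj (Suc n) (X(v := s)) v"
        then obtain w where w: "adj v w" "(X(v := s)) w < s" "descending_path adj n (X(v := s)) w"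
          by auto
        then have "w \<noteq> v" by auto
        then show "X \<in> (\<Union>w\<in>{w. adj v w}. {X. descending_path adj n X w \<and> X w < s})"
          using w descending_path_avoids_later[of adj n X v s w] by auto
      qed
    qed
    also have "\<dots> \<le> (\<Sum>w\<in>{w. adj v w}. measure clocks {X. descending_path adj n X w \<and> X w < s})"
      using fin sets by (intro measure_UNION_le) auto
    also have "\<dots> \<le> (\<Sum>w\<in>{w. adj v w}. real C ^ n * s ^ Suc n / fact (Suc n))"
      by (intro sum_mono Suc.IH) (use that in linarith)+
    also have "\<dots> = card {w. adj v w} * (C ^ n * s ^ Suc n / fact (Suc n))"
      by simp
    also have "\<dots> \<le> C * (C ^ n * s ^ Suc n / fact (Suc n))"
      using deg[of v] that by (intro mult_right_mono) auto
    also have "\<dots> = K * s ^ Suc n" by (simp add: K_def)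
    finally show ?thesis using True by simp
  qed simp
  have "measure clocks {X. descending_path adj (Suc n) X v \<and> X v < t}
      = (\<integral>s. measure clocks {X. descending_path adj (Suc n) (X(v := s)) v \<and> (X(v := s)) v < t} \<partial>uniform_clock)"
    by (rule prob_resample) measurable
  also have "\<dots> \<le> (\<integral>s. (if s < t then K * s ^ Suc n else 0) \<partial>uniform_clock)"
  proof (rule integral_mono_AE')
    show "integrable uniform_clock (\<lambda>s. if s < t then K * s ^ Suc n else 0)"
    proof (rule uniform_clock.integrable_const_bound[where B = K])
      show "AE s in uniform_clock. norm (if s < t then K * s ^ Suc n else 0) \<le> K"
      proof (rule AE_uniform_clock)
        fix s :: real assume "0 < s" "s < 1"
        then have "0 \<le> s ^ Suc n" "s ^ Suc n \<le> 1" by (simp, intro power_le_one) auto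
        moreover have "0 \<le> K" by (simp add: K_def)
        ultimately show "norm (if s < t then K * s ^ Suc n else 0) \<le> K"
          unfolding real_norm_def by (auto simp only: abs_mult abs_of_nonneg abs_zero mult_left_le split: if_split)
      qed
      show "(\<lambda>s. if s < t then K * s ^ Suc n else 0) \<in> borel_measurable uniform_clock"
        unfolding measurable_cong_sets[OF sets_uniform_clock refl] by measurable
    qed
    show "AE s in uniform_clock. measure clocks {X. descending_path adj (Suc n) (X(v := s)) v \<and> (X(v := s)) v < t}
        \<le> (if s < t then K * s ^ Suc n else 0)"
      by (rule AE_uniform_clock) (rule bound)
    show "AE s in uniform_clock. 0 \<le> (if s < t then K * s ^ Suc n else 0)"
      by (rule AE_uniform_clock) (simp add: K_def)
  qed
  also have "\<dots> = K * t ^ Suc (Suc n) / Suc (Suc n)"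
    by (rule integral_power_before) (use Suc.prems in auto)
  also have "\<dots> = real C ^ Suc n * t ^ Suc (Suc n) / fact (Suc (Suc n))"
    by (simp add: K_def field_simps)
  finally show ?case .
qed

lemma prob_descending_path_le:
  assumes fin: "\<And>x. finite {y. adj x y}" and deg: "\<And>x. card {y. adj x y} \<le> C"
  shows "measure clocks {X. descending_path adj n X v} \<le> real C ^ n / fact (Suc n)"
proof -
  note [measurable] = measurable_descending_path[OF fin]
  have m: "{X. descending_path adj n X v \<and> X v < 1} \<in> sets clocks" "{X. X v < 1} \<in> sets clocks"
    by (intro sets_pred_clocks; simp add: fin)+
  have "measure clocks {X. descending_path adj n X v}
      \<le> measure clocks ({X. descending_path adj n X v \<and> X v < 1} \<union> (space clocks - {X. X v < 1}))"
    by (intro clocks.finite_measure_mono sets.Un sets.compl_sets m) auto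
  also have "\<dots> \<le> measure clocks {X. descending_path adj n X v \<and> X v < 1}
      + measure clocks (space clocks - {X. X v < 1})"
    by (intro measure_Un_le sets.compl_sets m)
  also have "measure clocks (space clocks - {X. X v < 1}) = 0"
    unfolding clocks.prob_compl[OF m(2)] by (simp add: prob_clock_less)
  also have "measure clocks {X. descending_path adj n X v \<and> X v < 1} + 0 = measure clocks {X. descending_path adj n X v \<and> X v < 1}"
    by simp
  also have "\<dots> \<le> real C ^ n * 1 ^ Suc n / fact (Suc n)"
    by (rule prob_descending_path_before_le[OF fin deg]) auto
  finally show ?thesis by simp
qed

lemma vacancy_local:
  assumes graph: "\<And>x. finite {y. adj x y}" "\<And>x. card {y. adj x y} \<le> C"
    and fin: "finite W" "finite W'"
    and agree: "\<And>u. u \<in> ball_of_radius adj n v \<Longrightarrow> u \<in> W \<longleftrightarrow> u \<in> W'"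
  shows "\<bar>vacancy adj W {v} t - vacancy adj W' {v} t\<bar> \<le> real C ^ n / fact (Suc n)"
proof -
  let ?D = "{X. descending_path adj n X v}"
  have D: "?D \<in> sets clocks"
    by (rule sets_pred_clocks) (rule measurable_descending_path[OF graph(1)])
  have *: "vacancy adj W1 {v} t \<le> vacancy adj W2 {v} t + real C ^ n / fact (Suc n)"
    if fin: "finite W1" "finite W2" and "\<And>u. u \<in> ball_of_radius adj n v \<Longrightarrow> u \<in> W1 \<longleftrightarrow> u \<in> W2"
    for W1 W2
  proof -
    have S: "{X. vacant_before adj W2 {v} t X} \<in> sets clocks"
      by (intro sets_pred_clocks measurable_vacant_before) (use fin in auto)
    have "vacancy adj W1 {v} t \<le> measure clocks ({X. vacant_before adj W2 {v} t X} \<union> ?D)"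
      unfolding vacancy_def
      by (rule clocks.finite_measure_mono)
         (use occupied_local[OF fin _ that(3)] S D in \<open>auto simp: vacant_before_def\<close>)
    also have "\<dots> \<le> vacancy adj W2 {v} t + measure clocks ?D"
      unfolding vacancy_def by (intro measure_Un_le S D)
    also have "measure clocks ?D \<le> real C ^ n / fact (Suc n)"
      by (rule prob_descending_path_le[OF graph])
    finally show ?thesis by simp
  qed
  show ?thesis using *[of W W'] *[of W' W] fin agree by fastforce
qed

section \<open>Invariance under automorphisms\<close>

lemma restrict_UNIV: "restrict f UNIV = f"
  by (simp add: restrict_def)

lemma distr_clocks_reindex:
  assumes "inj \<psi>"
  shows "distr clocks clocks (\<lambda>X. X \<circ> \<psi>) = clocks"
  using distr_PiM_reindex[of UNIV "\<lambda>_. uniform_clock" \<psi> UNIV] assms prob_space_uniform_clock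
  by (simp add: clocks_def comp_def restrict_UNIV)

lemma occupied_automorphism:
  assumes "finite W" "bij \<psi>" "\<And>x y. adj (\<psi> x) (\<psi> y) \<longleftrightarrow> adj x y"
  shows "occupied_on_arrival adj (\<psi> ` W) X (\<psi> v) \<longleftrightarrow> occupied_on_arrival adj W (X \<circ> \<psi>) v"
  using assms(1)
proof (induction v rule: arrival_time_induct[where X = "X \<circ> \<psi>"])
  case (earlier v)
  have fin: "finite (\<psi> ` W)" using assms(1) by simp
  have "\<psi> v \<in> \<psi> ` W \<longleftrightarrow> v \<in> W" using assms(2) by (simp add: bij_is_inj inj_image_mem_iff)
  then show ?case
    unfolding occupied_iff[OF assms(1), of adj _ v] occupied_iff[OF fin, of adj X "\<psi> v"]
    using earlier assms(3) by (auto simp: comp_def)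
qed

lemma vacancy_automorphism:
  assumes "finite W" "bij \<psi>" "\<And>x y. adj (\<psi> x) (\<psi> y) \<longleftrightarrow> adj x y"
  shows "vacancy adj (\<psi> ` W) {\<psi> v} t = vacancy adj W {v} t"
proof -
  have m: "(\<lambda>X. X \<circ> \<psi>) \<in> measurable clocks clocks"
    by (rule measurable_clocksI) (simp add: comp_def)
  have s: "{X. vacant_before adj W {v} t X} \<in> sets clocks"
    by (intro sets_pred_clocks measurable_vacant_before) (use assms in auto)
  have "vacancy adj W {v} t = measure (distr clocks clocks (\<lambda>X. X \<circ> \<psi>)) {X. vacant_before adj W {v} t X}"
    using assms by (simp add: distr_clocks_reindex bij_is_inj vacancy_def)
  also have "\<dots> = measure clocks ((\<lambda>X. X \<circ> \<psi>) -` {X. vacant_before adj W {v} t X} \<inter> space clocks)"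
    by (rule measure_distr[OF m s])
  also have "\<dots> = vacancy adj (\<psi> ` W) {\<psi> v} t"
    unfolding vacancy_def
    by (rule arg_cong[where f = "measure clocks"])
       (auto simp: vacant_before_def occupied_automorphism[where adj = adj and \<psi> = \<psi>, OF assms])
  finally show ?thesis by simp
qed

lemma ball_automorphism:
  assumes "bij \<psi>" "\<And>x y. adj (\<psi> x) (\<psi> y) \<longleftrightarrow> adj x y"
  shows "\<psi> ` ball_of_radius adj n v = ball_of_radius adj n (\<psi> v)"
proof (induction n arbitrary: v)
  case (Suc n)
  have "{w. adj (\<psi> v) w} = \<psi> ` {w. adj v w}"
  proof safe
    fix w assume "adj (\<psi> v) w"
    moreover obtain u where "w = \<psi> u" using assms(1) by (metis bij_pointE)
    ultimately show "w \<in> \<psi> ` {w. adj v w}" using assms(2) by auto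
  qed (use assms(2) in auto)
  then show ?case by (simp add: image_UN Suc.IH)
qed simp

section \<open>Comparison with the regular tree\<close>

text \<open>
  While \<open>y\<close> is positive the inequality says that \<open>y ^ (1 - k)\<close> grows at least at rate \<open>k - 1\<close>.
  Since \<open>y\<close> is decreasing, it is positive on all of \<open>[0, t]\<close> if it is positive at \<open>t\<close>.
\<close>

lemma ode_comparison:
  fixes y :: "real \<Rightarrow> real"
  assumes k: "k \<ge> 2" and cont: "continuous_on {0..1} y" and y0: "y 0 \<le> 1"
    and deriv: "\<And>s. 0 < s \<Longrightarrow> s < 1 \<Longrightarrow> \<exists>D. (y has_real_derivative D) (at s) \<and> D \<le> - (max 0 (y s) ^ k)"
    and t: "0 \<le> t" "t \<le> 1"
  shows "y t \<le> (1 + (real k - 1) * t) powr (- 1 / (real k - 1))"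
proof (cases "y t \<le> 0")
  case True
  then show ?thesis by (rule order_trans) simp
next
  case False
  define m where "m = k - 1"
  have m: "k = Suc m" "m \<ge> 1" "real m = real k - 1" using k by (auto simp: m_def)
  have pos: "y s > 0" if s: "0 \<le> s" "s \<le> t" for s
  proof -
    have "- y s \<le> - y t"
    proof (rule DERIV_nonneg_imp_increasing_open[OF \<open>s \<le> t\<close>])
      fix x assume "s < x" "x < t"
      then obtain D where D: "(y has_real_derivative D) (at x)" "D \<le> - (max 0 (y x) ^ k)"
        using deriv[of x] s t by auto
      have "0 \<le> max 0 (y x) ^ k" by simp
      with D(2) have "0 \<le> - D" by linarith
      with DERIV_minus[OF D(1)] show "\<exists>D. ((\<lambda>x. - y x) has_real_derivative D) (at x) \<and> D \<ge> 0"
        by blast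
    next
      show "continuous_on {s..t} (\<lambda>x. - y x)"
        using that t by (intro continuous_intros continuous_on_subset[OF cont]) auto
    qed
    then show ?thesis using False by simp
  qed
  define h where "h s = inverse (y s ^ m) - real m * s" for s
  have "h 0 \<le> h t"
  proof (rule DERIV_nonneg_imp_increasing_open[OF \<open>0 \<le> t\<close>])
    fix s assume s: "0 < s" "s < t"
    then obtain D where D: "(y has_real_derivative D) (at s)" "D \<le> - (max 0 (y s) ^ k)"
      using deriv[of s] t by auto
    have ys: "y s > 0" using pos[of s] s by simp
    have "(h has_real_derivative - (inverse (y s ^ m) * (real m * (D * y s ^ (m - Suc 0))) * inverse (y s ^ m)) - real m) (at s)"
      unfolding h_def[abs_def] using ys
      by (auto intro!: derivative_eq_intros D(1))
    moreover have "- (inverse (y s ^ m) * (real m * (D * y s ^ (m - Suc 0))) * inverse (y s ^ m)) - real m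
        = real m * (- D / y s ^ k - 1)"
      unfolding m(1) using ys m(2) by (cases m) (auto simp: field_simps)
    moreover have "- D / y s ^ k \<ge> 1"
    proof -
      have "0 < y s ^ k" "y s ^ k \<le> - D" using D(2) ys by simp_all
      then show ?thesis by (metis le_divide_eq_1_pos)
    qed
    ultimately show "\<exists>D. (h has_real_derivative D) (at s) \<and> D \<ge> 0"
      by auto
  next
    have "continuous_on {0..t} y" using t by (intro continuous_on_subset[OF cont]) auto
    then have y_m: "continuous_on {0..t} (\<lambda>s. y s ^ m)" by (rule continuous_on_power)
    have "y s ^ m \<noteq> 0" if "s \<in> {0..t}" for s using pos[of s] that by simp
    then have "continuous_on {0..t} (\<lambda>s. inverse (y s ^ m))"
      by (intro continuous_on_inverse y_m) blast
    then show "continuous_on {0..t} h"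
      unfolding h_def[abs_def] by (rule continuous_on_diff) (intro continuous_intros)
  qed
  moreover have "1 \<le> inverse (y 0 ^ m)"
    using pos[of 0] y0 t by (intro one_le_inverse power_le_one) auto
  ultimately have le: "1 + real m * t \<le> inverse (y t ^ m)"
    by (simp add: h_def)
  have yt: "y t > 0" using False by simp
  have "0 \<le> real m * t" using t by simp
  have "y t = (y t ^ m) powr (1 / real m)"
    using yt m by (simp add: powr_realpow[symmetric] powr_powr)
  also have "\<dots> \<le> inverse (1 + real m * t) powr (1 / real m)"
  proof (rule powr_mono2)
    show "y t ^ m \<le> inverse (1 + real m * t)"
      using le_imp_inverse_le[OF le] \<open>0 \<le> real m * t\<close> by simp
  qed (use yt in auto)
  also have "\<dots> = (1 + real m * t) powr - (1 / real m)"
    by (simp only: powr_minus inverse_powr)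
  finally show ?thesis using m(3) by (simp only: minus_divide_left)
qed

text \<open>
  Automorphisms are taken to be bijections of the whole type, so that they act on families of
  arrival times by composition; outside \<open>V\<close> there are no edges, so nothing is lost.
\<close>

locale regular_bipartite_lattice = two_coloured_graph adj A
  for adj :: "'a \<Rightarrow> 'a \<Rightarrow> bool" and A :: "'a set" +
  fixes V :: "'a set" and k :: nat
  assumes adj_V: "adj x y \<Longrightarrow> x \<in> V \<and> y \<in> V"
    and adj_sym: "adj x y \<Longrightarrow> adj y x"
    and k_ge_2: "k \<ge> 2"
    and degree: "v \<in> V \<Longrightarrow> card {u. adj v u} = k + 1"
    and edge_transitive: "adj v1 v2 \<Longrightarrow> adj w1 w2 \<Longrightarrow>
      \<exists>\<phi>. bij \<phi> \<and> (\<forall>x y. adj (\<phi> x) (\<phi> y) \<longleftrightarrow> adj x y) \<and> \<phi> v1 = w1 \<and> \<phi> v2 = w2"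
begin

lemma finite_neighbours: "finite {u. adj v u}"
proof (cases "v \<in> V")
  case True
  then show ?thesis using degree[of v] by (intro card_ge_0_finite) simp
next
  case False
  then have "{u. adj v u} = {}" using adj_V by auto
  then show ?thesis by simp
qed

lemma degree_le: "card {u. adj v u} \<le> k + 1"
proof (cases "v \<in> V")
  case False
  then have "{u. adj v u} = {}" using adj_V by auto
  then show ?thesis by simp
qed (use degree in simp)

abbreviation ball :: "nat \<Rightarrow> 'a \<Rightarrow> 'a set" where
  "ball \<equiv> ball_of_radius adj"

lemma finite_ball': "finite (ball n v)"
  by (intro finite_ball finite_neighbours)

definition locality_error :: "nat \<Rightarrow> real" where
  "locality_error n = real (k + 1) ^ n / fact (Suc n)"

lemma locality_error_nonneg: "0 \<le> locality_error n"
  by (simp add: locality_error_def)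

lemma locality_error_tendsto_0: "locality_error \<longlonglongrightarrow> 0"
proof (rule tendsto_sandwich)
  show "\<forall>\<^sub>F n in sequentially. 0 \<le> locality_error n"
    by (simp add: locality_error_nonneg)
  show "\<forall>\<^sub>F n in sequentially. locality_error n \<le> real (k + 1) ^ n / fact n"
    unfolding locality_error_def
    by (intro always_eventually allI divide_left_mono fact_mono mult_pos_pos) auto
  show "(\<lambda>n. real (k + 1) ^ n / fact n) \<longlonglongrightarrow> 0"
    using summable_exp[of "real (k + 1)"]
    by (intro summable_LIMSEQ_zero) (simp add: field_simps)
qed simp

lemma vacancy_locality:
  assumes "finite W" "finite W'" "\<And>u. u \<in> ball n v \<Longrightarrow> u \<in> W \<longleftrightarrow> u \<in> W'"
  shows "\<bar>vacancy adj W {v} t - vacancy adj W' {v} t\<bar> \<le> locality_error n"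
  unfolding locality_error_def using assms
  by (intro vacancy_local finite_neighbours degree_le) auto

text \<open>
  The vacancy of \<open>w\<close> in the graph without its neighbour \<open>v\<close> is called a cavity vacancy.  By
  edge transitivity it does not depend on the oriented edge when the graph is all of \<open>V\<close>; in a
  finite subgraph it almost does not, as long as a large ball is contained.
\<close>

lemma cavity_vacancy_edge_independent:
  assumes e: "adj v w" "adj v' w'" and W: "finite W" "ball n w \<subseteq> W" "finite W'" "ball n w' \<subseteq> W'"
  shows "\<bar>vacancy adj (W - {v}) {w} t - vacancy adj (W' - {v'}) {w'} t\<bar> \<le> locality_error n"
proof -
  obtain \<phi> where \<phi>: "bij \<phi>" "\<And>x y. adj (\<phi> x) (\<phi> y) \<longleftrightarrow> adj x y" "\<phi> v = v'" "\<phi> w = w'"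
    using edge_transitive[OF e] by blast
  have "vacancy adj (W - {v}) {w} t = vacancy adj (\<phi> ` (W - {v})) {\<phi> w} t"
    by (rule vacancy_automorphism[symmetric]) (use W \<phi> in auto)
  also have "\<phi> ` (W - {v}) = \<phi> ` W - {v'}"
    using \<phi>(1,3) by (auto simp: image_set_diff bij_is_inj)
  finally have *: "vacancy adj (W - {v}) {w} t = vacancy adj (\<phi> ` W - {v'}) {w'} t"
    by (simp add: \<phi>(4))
  have "ball n w' \<subseteq> \<phi> ` W"
    using ball_automorphism[of \<phi> adj n w, OF \<phi>(1,2)] W(2) \<phi>(4) by auto
  then show ?thesis
    unfolding * using W by (intro vacancy_locality) auto
qed

lemma vacancy_vertex_independent:
  assumes e: "adj v w" and W: "finite W" "ball n v \<subseteq> W" "ball n w \<subseteq> W"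
  shows "\<bar>vacancy adj W {v} t - vacancy adj W {w} t\<bar> \<le> locality_error n"
proof -
  obtain \<phi> where \<phi>: "bij \<phi>" "\<And>x y. adj (\<phi> x) (\<phi> y) \<longleftrightarrow> adj x y" "\<phi> v = w"
    using edge_transitive[OF e adj_sym[OF e]] by blast
  have *: "vacancy adj W {v} t = vacancy adj (\<phi> ` W) {w} t"
    using vacancy_automorphism[of W \<phi> adj v t, OF W(1) \<phi>(1,2)] \<phi>(3) by simp
  have "ball n w \<subseteq> \<phi> ` W"
    using ball_automorphism[of \<phi> adj n v, OF \<phi>(1,2)] W(2) \<phi>(3) by auto
  then show ?thesis
    unfolding * using W by (intro vacancy_locality) auto
qed

text \<open>
  The solution of \<open>q' = - q ^ k\<close>, \<open>q 0 = 1\<close>: the probability that the root of the tree in which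
  every vertex has \<open>k\<close> children is vacant.
\<close>

definition tree_vacancy :: "real \<Rightarrow> real" where
  "tree_vacancy t = (1 + (real k - 1) * t) powr (- 1 / (real k - 1))"

text \<open>
  The cavity vacancy \<open>b\<close> satisfies \<open>b' \<le> - max 0 (b - e) ^ k\<close>, where \<open>e\<close> is the price for
  identifying the \<open>k\<close> cavity vacancies at the neighbours of \<open>w\<close> with \<open>b\<close> itself.  The shifted
  function \<open>b - e\<close> is then a subsolution of the equation of the tree, already on a finite graph.
\<close>

lemma cavity_vacancy_le:
  assumes e: "adj v w" and W: "finite W" "ball (Suc n) w \<subseteq> W" and t: "0 \<le> t" "t \<le> 1"
  shows "vacancy adj (W - {v}) {w} t \<le> tree_vacancy t + locality_error n"
proof -
  let ?e = "locality_error n"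
  let ?N = "{u \<in> W - {v}. adj w u}"
  define b where "b = vacancy adj (W - {v}) {w}"
  have "v \<noteq> w" using irrefl e by auto
  have nb: "u \<in> ball (Suc n) w" if "adj w u" for u
    using that centre_in_ball[of u adj n] by auto
  have vW: "v \<in> W" and wW: "w \<in> W"
    using W(2) nb adj_sym[OF e] centre_in_ball[of w adj "Suc n"] by auto
  have card_N: "card ?N = k"
  proof -
    have "?N = {u. adj w u} - {v}" using nb W(2) by auto
    moreover have "w \<in> V" using adj_V e by blast
    ultimately show ?thesis
      using degree[of w] adj_sym[OF e] finite_neighbours by (simp add: card_Diff_singleton)
  qed
  have fin_N: "finite ?N" using W by simp
  have "b t - ?e \<le> (1 + (real k - 1) * t) powr (- 1 / (real k - 1))"
  proof (rule ode_comparison[OF k_ge_2 _ _ _ t])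
    show "continuous_on {0..1} (\<lambda>s. b s - ?e)"
      unfolding b_def using W by (intro continuous_intros continuous_on_vacancy) auto
    show "b 0 - ?e \<le> 1"
      using vacancy_bounds(2)[of adj "W - {v}" "{w}" 0] locality_error_nonneg[of n] by (simp add: b_def)
    fix s :: real assume s: "0 < s" "s < 1"
    define d where "d = vacancy adj (W - {v} - {w}) ?N s"
    have "(b has_real_derivative - d) (at s)"
      unfolding b_def d_def using W wW s \<open>v \<noteq> w\<close> irrefl by (intro vacancy_has_derivative) auto
    moreover have "max 0 (b s - ?e) ^ k \<le> d"
    proof -
      have "max 0 (b s - ?e) ^ k = (\<Prod>u\<in>?N. max 0 (b s - ?e))"
        using card_N by simp
      also have "\<dots> \<le> (\<Prod>u\<in>?N. vacancy adj (W - {w}) {u} s)"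
      proof (rule prod_mono)
        fix u assume u: "u \<in> ?N"
        have "ball n u \<subseteq> W" using u W(2) by auto
        moreover have "ball n w \<subseteq> W" using ball_mono_Suc[of adj n w] W(2) by blast
        ultimately have "\<bar>vacancy adj (W - {w}) {u} s - b s\<bar> \<le> ?e"
          unfolding b_def using u e W by (intro cavity_vacancy_edge_independent) auto
        then show "0 \<le> max 0 (b s - ?e) \<and> max 0 (b s - ?e) \<le> vacancy adj (W - {w}) {u} s"
          using vacancy_bounds(1)[of adj "W - {w}" "{u}" s] by auto
      qed
      also have "\<dots> \<le> d"
        unfolding d_def using W vW wW adj_sym[OF e] by (intro cavity_vacancy_ge) auto
      finally show ?thesis .
    qed
    ultimately show "\<exists>D. ((\<lambda>s. b s - ?e) has_real_derivative D) (at s) \<and> D \<le> - (max 0 (b s - ?e) ^ k)"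
      by (intro exI[of _ "- d"] conjI) (auto intro!: derivative_eq_intros)
  qed
  then show ?thesis by (simp add: b_def tree_vacancy_def)
qed

text \<open>
  The two ends of an edge are vacant with nearly the same probability, so the pair inequality
  bounds twice the vacancy probability of \<open>v\<close>.
\<close>

lemma vacancy_le:
  assumes e: "adj v w" and W: "finite W" "ball (Suc (Suc n)) v \<subseteq> W" and t: "0 \<le> t" "t \<le> 1"
  shows "vacancy adj W {v} t \<le> (1 + locality_error n + (tree_vacancy t + locality_error n)\<^sup>2) / 2"
proof -
  let ?e = "locality_error n"
  have B: "ball (Suc n) w \<subseteq> W" "ball (Suc n) v \<subseteq> W" "ball n w \<subseteq> W" "ball n v \<subseteq> W"
    using W(2) ball_neighbour[where adj = adj, OF e, of "Suc n"] ball_mono_Suc[of adj "Suc n" v]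
      ball_mono_Suc[of adj n v] ball_mono_Suc[of adj n w]
    by (meson order_trans)+
  have vw: "v \<in> W" "w \<in> W"
    using B centre_in_ball[of v adj n] centre_in_ball[of w adj n] by auto
  have "vacancy adj W {v} t + vacancy adj W {w} t - 1
      \<le> vacancy adj (W - {v}) {w} t * vacancy adj (W - {w}) {v} t"
    using W vw e adj_sym[OF e] t by (intro vacancy_pair_le) auto
  also have "\<dots> \<le> (tree_vacancy t + ?e) * (tree_vacancy t + ?e)"
    using W B t e adj_sym[OF e] locality_error_nonneg[of n]
    by (intro mult_mono cavity_vacancy_le vacancy_bounds) (auto simp: tree_vacancy_def)
  finally show ?thesis
    using vacancy_vertex_independent[OF e W(1) B(4,3), of t]
    by (simp add: power2_eq_square)
qed

end

section \<open>The process on the whole lattice\<close>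

text \<open>
  The random variables of an arbitrary probability space may be replaced by the canonical ones
  in every event that concerns finitely many vertices.
\<close>

lemma iid_uniform_event:
  fixes \<tau> :: "'a \<Rightarrow> 'w \<Rightarrow> real"
  assumes M: "prob_space M" and iid: "iid_uniform M \<tau> V"
    and W: "finite W" "W \<noteq> {}" "W \<subseteq> V"
    and Q: "Measurable.pred clocks Q"
    and dep: "\<And>X Y. (\<And>u. u \<in> W \<Longrightarrow> X u = Y u) \<Longrightarrow> Q X \<longleftrightarrow> Q Y"
  shows "{\<omega> \<in> space M. Q (\<lambda>u. \<tau> u \<omega>)} \<in> sets M"
    and "measure M {\<omega> \<in> space M. Q (\<lambda>u. \<tau> u \<omega>)} = measure clocks {X. Q X}"
proof -
  interpret M: prob_space M by fact
  let ?P = "\<Pi>\<^sub>M i\<in>W. (borel :: real measure)" and ?U = "\<Pi>\<^sub>M i\<in>W. uniform_clock"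
  define h :: "('a \<Rightarrow> real) \<Rightarrow> 'a \<Rightarrow> real" where "h x = (\<lambda>u. if u \<in> W then x u else 0)" for x
  have h: "h \<in> measurable ?P clocks"
  proof (rule measurable_clocksI)
    fix u show "(\<lambda>x. h x u) \<in> borel_measurable ?P"
      by (cases "u \<in> W") (auto simp: h_def)
  qed
  have sets_eq: "sets ?U = sets ?P" by (rule sets_PiM_cong) auto
  have indep: "M.indep_vars (\<lambda>_. borel) \<tau> W"
    using iid W(3) by (auto simp: iid_uniform_def intro: M.indep_vars_subset)
  have rv: "\<tau> u \<in> borel_measurable M" if "u \<in> W" for u
    using indep that by (auto simp: M.indep_vars_def)
  have T: "(\<lambda>\<omega>. \<lambda>u\<in>W. \<tau> u \<omega>) \<in> measurable M ?P"
    using rv by (rule measurable_restrict)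
  have "distr M ?P (\<lambda>\<omega>. \<lambda>u\<in>W. \<tau> u \<omega>) = (\<Pi>\<^sub>M u\<in>W. distr M borel (\<tau> u))"
    using indep W rv by (subst (asm) M.indep_vars_iff_distr_eq_PiM') auto
  also have "\<dots> = ?U"
    using iid W(3) by (intro PiM_cong) (auto simp: iid_uniform_def)
  finally have distr_M: "distr M ?P (\<lambda>\<omega>. \<lambda>u\<in>W. \<tau> u \<omega>) = ?U" .
  interpret product_prob_space "\<lambda>_ :: 'a. uniform_clock" UNIV ..
  have distr_C: "distr clocks ?U (\<lambda>X. restrict X W) = ?U"
    unfolding clocks_def using W by (intro distr_PiM_restrict_finite) auto
  have R: "(\<lambda>X. restrict X W) \<in> measurable clocks ?U"
    unfolding clocks_def by (rule measurable_restrict_subset) simp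
  define S where "S = {x \<in> space ?P. Q (h x)}"
  have S: "S \<in> sets ?P"
    unfolding S_def using measurable_compose[OF h Q] by (simp add: pred_def)
  have eq_M: "{\<omega> \<in> space M. Q (\<lambda>u. \<tau> u \<omega>)} = (\<lambda>\<omega>. \<lambda>u\<in>W. \<tau> u \<omega>) -` S \<inter> space M"
    unfolding S_def using dep[of "h (\<lambda>u\<in>W. \<tau> u _)" "\<lambda>u. \<tau> u _"]
    by (auto simp: h_def space_PiM)
  have eq_C: "{X. Q X} = (\<lambda>X. restrict X W) -` S \<inter> space clocks"
    unfolding S_def using dep[of "h (restrict _ W)"]
    by (auto simp: h_def space_PiM)
  show "{\<omega> \<in> space M. Q (\<lambda>u. \<tau> u \<omega>)} \<in> sets M"
    unfolding eq_M by (rule measurable_sets[OF T S])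
  have "measure M {\<omega> \<in> space M. Q (\<lambda>u. \<tau> u \<omega>)} = measure ?U S"
    unfolding eq_M using measure_distr[OF T S] distr_M by simp
  also have "\<dots> = measure clocks {X. Q X}"
    unfolding eq_C using measure_distr[OF R, of S] S sets_eq distr_C by simp
  finally show "measure M {\<omega> \<in> space M. Q (\<lambda>u. \<tau> u \<omega>)} = measure clocks {X. Q X}" .
qed

text \<open>
  Without a long descending path from \<open>v\<close> the approximating sequence is eventually constant at
  \<open>v\<close>, and its limit is already attained on one finite set.
\<close>

lemma (in regular_bipartite_lattice) rsa_eq_rsa_finite:
  assumes "exhausts Vn V" "v \<in> V"
  obtains W where "finite W" "W \<subseteq> V" "ball n v \<subseteq> W"
    "\<And>X t. \<not> descending_path adj n X v \<Longrightarrow> rsa adj V Vn X t v = rsa_finite adj W X t v"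
proof (cases "finite V")
  case True
  moreover have "ball n v \<subseteq> V"
    using adj_V assms(2) by (intro ball_subset) auto
  ultimately show ?thesis by (intro that[of V]) (auto simp: rsa_def)
next
  case False
  have B: "ball n v \<subseteq> V"
    using adj_V assms(2) by (intro ball_subset) auto
  have Vn: "finite (Vn m)" "Vn m \<subseteq> V" for m
    using assms(1) by (auto simp: exhausts_def)
  have "\<forall>\<^sub>F m in sequentially. x \<in> Vn m" if "x \<in> ball n v" for x
  proof -
    have "x \<in> (\<Union>n. \<Inter>m\<in>{n..}. Vn m)"
      using assms(1) B that by (auto simp: exhausts_def)
    then show ?thesis by (auto simp: eventually_sequentially)
  qed
  then have "\<forall>\<^sub>F m in sequentially. \<forall>x\<in>ball n v. x \<in> Vn m"
    by (intro eventually_ball_finite finite_ball') auto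
  then obtain m0 where m0: "\<And>m. m \<ge> m0 \<Longrightarrow> ball n v \<subseteq> Vn m"
    unfolding eventually_sequentially by blast
  show ?thesis
  proof (rule that[of "Vn m0"])
    fix X t assume X: "\<not> descending_path adj n X v"
    have "rsa_finite adj (Vn m) X t v = rsa_finite adj (Vn m0) X t v" if "m0 \<le> m" for m
    proof -
      have "occupied_on_arrival adj (Vn m) X v = occupied_on_arrival adj (Vn m0) X v"
        using m0[OF that] m0[OF order_refl] by (intro occupied_local[OF Vn(1) Vn(1) X]) blast
      then show ?thesis by (simp only: rsa_finite_def)
    qed
    then have "\<forall>\<^sub>F m in sequentially. rsa_finite adj (Vn m) X t v = rsa_finite adj (Vn m0) X t v"
      using eventually_sequentially by blast
    then have "(\<lambda>m. rsa_finite adj (Vn m) X t v) \<longlonglongrightarrow> rsa_finite adj (Vn m0) X t v"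
      by (rule tendsto_eventually)
    then show "rsa adj V Vn X t v = rsa_finite adj (Vn m0) X t v"
      using False by (simp add: rsa_def limI)
  qed (use Vn m0 in auto)
qed

lemma sets_rsa_finite_event:
  assumes M: "prob_space M" "iid_uniform M \<tau> V" and W: "finite W" "W \<subseteq> V"
  shows "{\<omega> \<in> space M. rsa_finite adj W (\<lambda>u. \<tau> u \<omega>) t v = j} \<in> sets M"
proof (cases "v \<in> W")
  case True
  note [measurable] = measurable_occupied[OF W(1)]
  have "Measurable.pred clocks (\<lambda>X. rsa_finite adj W X t v = j)"
    unfolding rsa_finite_def by measurable
  moreover have "rsa_finite adj W X t v = j \<longleftrightarrow> rsa_finite adj W Y t v = j"
    if "\<And>u. u \<in> W \<Longrightarrow> X u = Y u" for X Y
  proof -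
    have "occupied_on_arrival adj W X v = occupied_on_arrival adj W Y v" "X v = Y v"
      using that True by (auto intro!: occupied_cong[OF W(1)])
    then show ?thesis by (simp only: rsa_finite_def)
  qed
  ultimately show ?thesis
    using True by (intro iid_uniform_event(1)[OF M W(1) _ W(2)]) blast+
next
  case False
  then have "rsa_finite adj W X t v = 0" for X
    using occupied_imp_mem[OF W(1)] by (auto simp: rsa_finite_def)
  then show ?thesis by simp
qed

text \<open>
  Where the sequence does not converge, its \<open>lim\<close> is an unspecified constant \<open>d\<close>, so the
  event either contains or misses the whole set of divergence.
\<close>

lemma sets_rsa_event:
  assumes M: "prob_space M" "iid_uniform M \<tau> V" and ex: "exhausts Vn V"
  shows "{\<omega> \<in> space M. rsa adj V Vn (\<lambda>u. \<tau> u \<omega>) t v = j} \<in> sets M"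
proof (cases "finite V")
  case True
  then show ?thesis using sets_rsa_finite_event[OF M True] by (simp add: rsa_def)
next
  case False
  define g where "g n \<omega> = rsa_finite adj (Vn n) (\<lambda>u. \<tau> u \<omega>) t v" for n \<omega>
  have g: "{\<omega> \<in> space M. g n \<omega> = c} \<in> sets M" for n c
    unfolding g_def using ex by (intro sets_rsa_finite_event[OF M]) (auto simp: exhausts_def)
  define E where "E c = {\<omega> \<in> space M. \<forall>\<^sub>F n in sequentially. g n \<omega> = c}" for c
  have E: "E c \<in> sets M" for c
    unfolding E_def eventually_sequentially
    by (intro sets.sets_Collect_countable_Ex sets.sets_Collect_countable_All
        sets.sets_Collect_imp sets.sets_Collect_const g)
  define d :: nat where "d = (THE L. False)"
  have lim: "lim (\<lambda>n. g n \<omega>) = (if \<exists>c. \<omega> \<in> E c then THE c. \<omega> \<in> E c else d)" if "\<omega> \<in> space M" for \<omega>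
  proof -
    have "lim (\<lambda>n. g n \<omega>) = (THE c. \<omega> \<in> E c)"
      unfolding lim_def E_def using that by (simp add: tendsto_discrete)
    moreover have "(THE c. \<omega> \<in> E c) = d" if "\<not> (\<exists>c. \<omega> \<in> E c)"
      using that by (simp add: d_def)
    ultimately show ?thesis by simp
  qed
  have uniq: "c = c'" if "\<omega> \<in> E c" "\<omega> \<in> E c'" for \<omega> c c'
  proof -
    have "\<forall>\<^sub>F n in sequentially. g n \<omega> = c \<and> g n \<omega> = c'"
      using that by (auto simp: E_def intro: eventually_conj)
    then show ?thesis by (auto simp: eventually_sequentially)
  qed
  have lim_iff: "lim (\<lambda>n. g n \<omega>) = j \<longleftrightarrow> \<omega> \<in> E j \<or> (d = j \<and> (\<forall>c. \<omega> \<notin> E c))"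
    if "\<omega> \<in> space M" for \<omega>
  proof (cases "\<exists>c. \<omega> \<in> E c")
    case True
    then obtain c where c: "\<omega> \<in> E c" by blast
    then have "(THE c. \<omega> \<in> E c) = c" using uniq by blast
    then have "lim (\<lambda>n. g n \<omega>) = c" using lim[OF that] True by simp
    then show ?thesis using c uniq by blast
  next
    case False
    then show ?thesis using lim[OF that] by simp
  qed
  have "E c \<subseteq> space M" for c by (auto simp: E_def)
  then have "{\<omega> \<in> space M. lim (\<lambda>n. g n \<omega>) = j} = E j \<union> (if d = j then space M - (\<Union>c. E c) else {})"
    using lim_iff by (cases "d = j") auto
  also have "\<dots> \<in> sets M" using E by auto
  finally show ?thesis using False by (simp add: rsa_def g_def)
qed

text \<open>
  The probability that a finite subgraph gives a different state is absorbed in an error term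
  that vanishes as the radius grows.
\<close>

lemma (in regular_bipartite_lattice) rsa_bounds:
  assumes M: "prob_space M" "iid_uniform M \<tau> V" and ex: "exhausts Vn V" and v: "v \<in> V"
    and t: "0 \<le> t" "t \<le> 1"
  shows "measure M {\<omega> \<in> space M. rsa adj V Vn (\<lambda>u. \<tau> u \<omega>) t v = 0} \<le> (1 + (tree_vacancy t)\<^sup>2) / 2"
    and "measure M {\<omega> \<in> space M. rsa adj V Vn (\<lambda>u. \<tau> u \<omega>) t v = 1} \<ge> 1 - (1 + (tree_vacancy t)\<^sup>2) / 2"
proof -
  interpret M: prob_space M by fact
  have "card {u. adj v u} > 0" using degree[OF v] by simp
  then obtain w where e: "adj v w" by (metis card_gt_0_iff empty_Collect_eq)
  define bnd where "bnd n = (1 + locality_error n + (tree_vacancy t + locality_error n)\<^sup>2) / 2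
      + locality_error (Suc (Suc n))" for n
  have "(\<lambda>n. locality_error (Suc (Suc n))) \<longlonglongrightarrow> 0"
    using locality_error_tendsto_0 by (intro LIMSEQ_Suc)
  then have "bnd \<longlonglongrightarrow> (1 + 0 + (tree_vacancy t + 0)\<^sup>2) / 2 + 0"
    unfolding bnd_def[abs_def] by (intro tendsto_intros locality_error_tendsto_0) auto
  then have bnd: "bnd \<longlonglongrightarrow> (1 + (tree_vacancy t)\<^sup>2) / 2" by simp
  have main: "measure M {\<omega> \<in> space M. rsa adj V Vn (\<lambda>u. \<tau> u \<omega>) t v = 0} \<le> bnd n \<and>
      measure M {\<omega> \<in> space M. rsa adj V Vn (\<lambda>u. \<tau> u \<omega>) t v = 1} \<ge> 1 - bnd n" for n
  proof -
    let ?m = "Suc (Suc n)"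
    obtain W where W: "finite W" "W \<subseteq> V" "ball ?m v \<subseteq> W"
      "\<And>X t. \<not> descending_path adj ?m X v \<Longrightarrow> rsa adj V Vn X t v = rsa_finite adj W X t v"
      by (rule rsa_eq_rsa_finite[OF ex v, of ?m]) blast
    have vW: "v \<in> W" using W(3) centre_in_ball[of v adj ?m] by blast
    define D where "D = {\<omega> \<in> space M. descending_path adj ?m (\<lambda>u. \<tau> u \<omega>) v}"
    define F where "F j = {\<omega> \<in> space M. rsa_finite adj W (\<lambda>u. \<tau> u \<omega>) t v = j}" for j
    define R where "R j = {\<omega> \<in> space M. rsa adj V Vn (\<lambda>u. \<tau> u \<omega>) t v = j}" for j
    have FM: "F j \<in> sets M" for j
      unfolding F_def by (rule sets_rsa_finite_event[OF M W(1,2)])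
    have RM: "R j \<in> sets M" for j
      unfolding R_def by (rule sets_rsa_event[OF M ex])
    have B: "finite (ball ?m v)" "ball ?m v \<noteq> {}" "ball ?m v \<subseteq> V"
      by (rule finite_ball', use centre_in_ball[of v adj ?m] in blast, rule order_trans[OF W(3,2)])
    have W_v: "W \<noteq> {}" "finite {v}" using vW by auto
    note D_events = iid_uniform_event[where Q = "\<lambda>X. descending_path adj ?m X v", OF M B
        measurable_descending_path[OF finite_neighbours] descending_path_cong]
    have DM: "D \<in> sets M"
      unfolding D_def by (rule D_events(1))
    have "measure M D = measure clocks {X. descending_path adj ?m X v}"
      unfolding D_def by (rule D_events(2))
    also have "\<dots> \<le> locality_error ?m"
      unfolding locality_error_def
      by (intro prob_descending_path_le finite_neighbours degree_le)
    finally have D_le: "measure M D \<le> locality_error ?m" .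
    note V_event = iid_uniform_event[OF M W(1) W_v(1) W(2), of "vacant_before adj W {v} t",
        OF measurable_vacant_before[OF W(1) W_v(2)] vacant_before_cong[OF W(1)]]
    have "measure M (F 0) \<le> measure M {\<omega> \<in> space M. vacant_before adj W {v} t (\<lambda>u. \<tau> u \<omega>)}"
      by (rule M.finite_measure_mono[OF _ V_event(1)])
         (auto simp: F_def rsa_finite_def vacant_before_def split: if_splits)
    also have "\<dots> = vacancy adj W {v} t"
      unfolding vacancy_def by (rule V_event(2))
    also have "\<dots> \<le> (1 + locality_error n + (tree_vacancy t + locality_error n)\<^sup>2) / 2"
      by (rule vacancy_le[OF e W(1,3) t])
    finally have F0: "measure M (F 0) + locality_error ?m \<le> bnd n" by (simp add: bnd_def)
    have "measure M (R 0) \<le> measure M (F 0 \<union> D)"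
      using W(4) by (intro M.finite_measure_mono sets.Un FM DM) (auto simp: R_def F_def D_def)
    also have "\<dots> \<le> measure M (F 0) + measure M D"
      by (intro measure_Un_le FM DM)
    finally have R0: "measure M (R 0) \<le> bnd n" using D_le F0 by linarith
    have "F 1 = space M - F 0"
      by (auto simp: F_def rsa_finite_def)
    then have "1 - measure M (F 0) = measure M (F 1)"
      using M.prob_compl[OF FM[of 0]] by simp
    also have "\<dots> \<le> measure M (R 1 \<union> D)"
      using W(4) by (intro M.finite_measure_mono sets.Un RM DM) (auto simp: R_def F_def D_def)
    also have "\<dots> \<le> measure M (R 1) + measure M D"
      by (intro measure_Un_le RM DM)
    finally have "measure M (R 1) \<ge> 1 - bnd n" using D_le F0 by linarith
    with R0 show ?thesis by (simp add: R_def)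
  qed
  show "measure M {\<omega> \<in> space M. rsa adj V Vn (\<lambda>u. \<tau> u \<omega>) t v = 0} \<le> (1 + (tree_vacancy t)\<^sup>2) / 2"
    using main by (intro LIMSEQ_le_const[OF bnd]) auto
  have "(\<lambda>n. 1 - bnd n) \<longlonglongrightarrow> 1 - (1 + (tree_vacancy t)\<^sup>2) / 2"
    by (intro tendsto_intros bnd)
  then show "measure M {\<omega> \<in> space M. rsa adj V Vn (\<lambda>u. \<tau> u \<omega>) t v = 1} \<ge> 1 - (1 + (tree_vacancy t)\<^sup>2) / 2"
    using main by (intro LIMSEQ_le_const2) auto
qed

lemma regular_bipartite_latticeI:
  assumes lat: "bipartite_lattice V adj" and "k \<ge> 2" and deg: "\<forall>u\<in>V. vertex_degree V adj u = k + 1"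
  obtains A where "regular_bipartite_lattice adj A V k"
proof -
  from lat have simple: "\<And>x y. adj x y \<Longrightarrow> x \<in> V \<and> y \<in> V \<and> x \<noteq> y \<and> adj y x"
    by (auto simp: bipartite_lattice_def simple_graph_def)
  from lat obtain A B where AB: "A \<union> B = V" "A \<inter> B = {}"
      "\<And>x y. adj x y \<Longrightarrow> (x \<in> A \<and> y \<in> B) \<or> (x \<in> B \<and> y \<in> A)"
    by (auto simp: bipartite_lattice_def bipartite_def)
  have "regular_bipartite_lattice adj A V k"
  proof unfold_locales
    show "x \<in> A \<longleftrightarrow> y \<notin> A" if "adj x y" for x y
      using AB(2) AB(3)[OF that] by blast
    show "card {u. adj v u} = k + 1" if "v \<in> V" for v
    proof -
      have "{u. adj v u} = {u \<in> V. adj v u}" using simple by auto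
      then show ?thesis using deg that by (simp add: vertex_degree_def)
    qed
    fix v1 v2 w1 w2 assume adj: "adj v1 v2" "adj w1 w2"
    then obtain \<phi> where \<phi>: "graph_automorphism V adj \<phi>" "\<phi> v1 = w1" "\<phi> v2 = w2"
      using lat unfolding bipartite_lattice_def by blast
    define \<psi> where "\<psi> x = (if x \<in> V then \<phi> x else x)" for x
    have "bij_betw \<psi> V V"
      using \<phi>(1) unfolding graph_automorphism_def by (auto simp: \<psi>_def cong: bij_betw_cong)
    moreover have "bij_betw \<psi> (- V) (- V)"
      by (auto simp: \<psi>_def bij_betw_def inj_on_def)
    ultimately have "bij \<psi>"
      using bij_betw_combine[of \<psi> V V "- V" "- V"] by simp
    moreover have "\<psi> x \<in> V \<longleftrightarrow> x \<in> V" for x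
      using \<phi>(1) by (auto simp: \<psi>_def graph_automorphism_def bij_betw_def)
    then have "adj (\<psi> x) (\<psi> y) \<longleftrightarrow> adj x y" for x y
    proof (cases "x \<in> V \<and> y \<in> V")
      case True
      then show ?thesis using \<phi>(1) by (simp add: \<psi>_def graph_automorphism_def)
    next
      case False
      then show ?thesis using simple \<open>\<And>x. \<psi> x \<in> V \<longleftrightarrow> x \<in> V\<close> by blast
    qed
    moreover have "\<psi> v1 = w1" "\<psi> v2 = w2"
      using \<phi>(2,3) simple[OF adj(1)] by (auto simp: \<psi>_def)
    ultimately show "\<exists>\<phi>. bij \<phi> \<and> (\<forall>x y. adj (\<phi> x) (\<phi> y) \<longleftrightarrow> adj x y) \<and> \<phi> v1 = w1 \<and> \<phi> v2 = w2"
      by blast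
  qed (use simple \<open>k \<ge> 2\<close> in auto)
  then show ?thesis by (rule that)
qed

theorem theorem6:
  fixes V :: "'a set" and adj :: "'a \<Rightarrow> 'a \<Rightarrow> bool" and k :: nat
    and M :: "'w measure" and \<tau> :: "'a \<Rightarrow> 'w \<Rightarrow> real"
    and Vn :: "nat \<Rightarrow> 'a set" and v :: 'a
  assumes "countable V"
    and "bipartite_lattice V adj"
    and "k \<ge> 2"
    and "\<forall>u\<in>V. vertex_degree V adj u = k + 1"
    and "prob_space M"
    and "iid_uniform M \<tau> V"
    and "exhausts Vn V"
    and "v \<in> V"
  shows "(\<forall>t\<in>{0..1}.
            \<P>(\<omega> in M. rsa adj V Vn (\<lambda>u. \<tau> u \<omega>) t v = 0)
              \<le> 1 / 2 * (1 + 1 / (1 + (real k - 1) * t) powr (2 / (real k - 1))))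
       \<and> \<P>(\<omega> in M. rsa adj V Vn (\<lambda>u. \<tau> u \<omega>) 1 v = 0)
              \<le> 1 / 2 * (1 + real k powr (- 2 / (real k - 1)))
       \<and> \<P>(\<omega> in M. rsa adj V Vn (\<lambda>u. \<tau> u \<omega>) 1 v = 1)
              \<ge> 1 / 2 * (1 - real k powr (- 2 / (real k - 1)))"
proof -
  obtain A where "regular_bipartite_lattice adj A V k"
    using regular_bipartite_latticeI[OF assms(2,3,4)] .
  then interpret regular_bipartite_lattice adj A V k .
  note bounds = rsa_bounds[OF assms(5-8)]
  have sq: "(tree_vacancy t)\<^sup>2 = (1 + (real k - 1) * t) powr (- 2 / (real k - 1))" for t
    by (simp add: tree_vacancy_def power2_eq_square powr_add[symmetric])
  show ?thesis
  proof (intro conjI ballI)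
    fix t :: real assume "t \<in> {0..1}"
    then show "\<P>(\<omega> in M. rsa adj V Vn (\<lambda>u. \<tau> u \<omega>) t v = 0)
        \<le> 1 / 2 * (1 + 1 / (1 + (real k - 1) * t) powr (2 / (real k - 1)))"
      using bounds(1)[of t] by (simp add: sq powr_minus_divide)
  next
    show "\<P>(\<omega> in M. rsa adj V Vn (\<lambda>u. \<tau> u \<omega>) 1 v = 0) \<le> 1 / 2 * (1 + real k powr (- 2 / (real k - 1)))"
      using bounds(1)[of 1] by (simp add: sq)
    show "\<P>(\<omega> in M. rsa adj V Vn (\<lambda>u. \<tau> u \<omega>) 1 v = 1) \<ge> 1 / 2 * (1 - real k powr (- 2 / (real k - 1)))"
      using bounds(2)[of 1] by (simp add: sq field_simps)
  qed
qed

end
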